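(* Let $k \ge 2$. For every real $a > 0$ and every integer $K \ge 1$, there exists an injective, volume preserving holomorphic map $F : \mathbb{C}^k \to \mathbb{C}^k$ such that, with the sets $V^a_l, D^a_l, E^a_l \subset \mathbb{C}$ defined in the context: (i) $V^a_{l_1} \times V^a_{l_2} \times \cdots \times V^a_{l_k}$ is disjoint from $F(\mathbb{C}^k)$ whenever $1 \le l_i \le K+1$ for every $1 \le i \le k$; (ii) $V^a_{-l_1} \times V^a_{-l_2} \times \cdots \times V^a_{-l_k}$ is disjoint from $F(\mathbb{C}^k)$ whenever $1 \le l_i \le K+1$ for every $1 \le i \le k$; (iii) $D^a_{l_1} \times D^a_{l_2} \times \cdots \times D^a_{l_k}$ is disjoint from $F(\mathbb{C}^k)$ whenever $1 \le |l_i| \le K+1$ for every $1 \le i \le k$; (iv) $E^a_{l_1} \times E^a_{l_2} \times \cdots \times E^a_{l_k} \subset F(\mathbb{C}^k)$ whenever $1 \le |l_i| \le K+1$ for every $1 \le i \le k$.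
   Context: Volume preserving means that the (holomorphic) Jacobian determinant is identically $1$. For $a>0$ and an integer $K \ge 1$ define the following subsets of $\mathbb{C}$: $V^a_l = \{z : a + (2l-1) \le \Re z \le a+2l\}$ for $1 \le l \le K$; $V^a_{K+1} = \{z : \Re z \ge a+2K+1\}$; $V^a_{-l} = \{z : -(a+2l) \le \Re z \le -(a+2l-1)\}$ for $1 \le l \le K$; $V^a_{-(K+1)} = \{z : \Re z \le -(a+2K+1)\}$. For an integer $l$ with $1 \le |l| \le K+1$ put $c_l = a + (4l-3)/2$ if $l>0$ and $c_l = -(a + (4|l|-3)/2)$ if $l<0$. For $n \in \mathbb{Z}$ let $D^n_l(a)$ be the (open) disc of radius $1/8$ centered at $c_l + 2n\,i$ and $E^n_l(a)$ the (open) disc of radius $1/8$ centered at $c_l + (2n+1)\,i$. Put $D^a_l = \bigcup_{n \in \mathbb{Z}} D^n_l(a)$ and $E^a_l = \bigcup_{n \in \mathbb{Z}} E^n_l(a)$. *)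

theory Defs
  imports "HOL-Analysis.Multivariate_Analysis"
begin

text \<open>The space \<open>\<complex>\<^sup>k\<close> is \<open>complex ^ 'k\<close> with \<open>k = CARD('k)\<close>.\<close>

text \<open>Holomorphy of a map on all of \<open>\<complex>\<^sup>k\<close>: at every point the Frechet derivative exists
  and is complex linear, i.e. it is multiplication by a complex matrix.\<close>

definition holomorphic_map :: "(complex ^ 'k \<Rightarrow> complex ^ 'm) \<Rightarrow> bool" where
  "holomorphic_map F \<longleftrightarrow>
    (\<forall>z. \<exists>A :: complex ^ 'k ^ 'm. (F has_derivative (\<lambda>h. A *v h)) (at z))"

text \<open>Entry \<open>(i, j)\<close> is \<open>\<partial>F\<^sub>i/\<partial>z\<^sub>j\<close>, the derivative being the complex one.\<close>

definition complex_jacobian :: "(complex ^ 'k \<Rightarrow> complex ^ 'm) \<Rightarrow> complex ^ 'k \<Rightarrow> complex ^ 'k ^ 'm" where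
  "complex_jacobian F z = (\<chi> i j. deriv (\<lambda>t. F (z + axis j t) $ i) 0)"

definition volume_preserving :: "(complex ^ 'k \<Rightarrow> complex ^ 'k) \<Rightarrow> bool" where
  "volume_preserving F \<longleftrightarrow> (\<forall>z. det (complex_jacobian F z) = 1)"

definition cart_prod :: "('k \<Rightarrow> complex set) \<Rightarrow> (complex ^ 'k) set" where
  "cart_prod S = {z. \<forall>i. z $ i \<in> S i}"

text \<open>Only indices with \<open>1 \<le> \<bar>l\<bar> \<le> K + 1\<close> are meaningful; the value \<open>{}\<close> for all others
  is a dummy.\<close>

definition V_set :: "real \<Rightarrow> int \<Rightarrow> int \<Rightarrow> complex set" where
  "V_set a K l =
    (if 1 \<le> l \<and> l \<le> K then {z. a + (2 * l - 1) \<le> Re z \<and> Re z \<le> a + 2 * l}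
     else if l = K + 1 then {z. Re z \<ge> a + 2 * K + 1}
     else if 1 \<le> -l \<and> -l \<le> K then {z. -(a + 2 * \<bar>l\<bar>) \<le> Re z \<and> Re z \<le> -(a + 2 * \<bar>l\<bar> - 1)}
     else if l = -(K + 1) then {z. Re z \<le> -(a + 2 * K + 1)}
     else {})"

definition c_centre :: "real \<Rightarrow> int \<Rightarrow> real" where
  "c_centre a l =
    (if l > 0 then a + (4 * real_of_int l - 3) / 2 else -(a + (4 * real_of_int \<bar>l\<bar> - 3) / 2))"

definition D_disc :: "real \<Rightarrow> int \<Rightarrow> int \<Rightarrow> complex set" where
  "D_disc a l n = ball (complex_of_real (c_centre a l) + 2 * of_int n * \<i>) (1 / 8)"

definition E_disc :: "real \<Rightarrow> int \<Rightarrow> int \<Rightarrow> complex set" where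
  "E_disc a l n = ball (complex_of_real (c_centre a l) + (2 * of_int n + 1) * \<i>) (1 / 8)"

definition D_set :: "real \<Rightarrow> int \<Rightarrow> complex set" where
  "D_set a l = (\<Union>n. D_disc a l n)"

definition E_set :: "real \<Rightarrow> int \<Rightarrow> complex set" where
  "E_set a l = (\<Union>n. E_disc a l n)"

end

theory Submission
  imports Defs "HOL-Complex_Analysis.Cauchy_Integral_Formula" "HOL-Computational_Algebra.Polynomial"
begin

text \<open>The sets to be avoided are swept to infinity by infinitely many volume preserving shears
  \<open>z \<mapsto> z + f (z\<^sub>i) v\<close> with \<open>v\<^sub>i = 0\<close>, while the sets to be covered move little; the inverse
  of the sweeping process is the required map.

  Each shear is governed by an entire function of one variable with prescribed behaviour on unbounded
  sets: close to \<open>0\<close> on some vertical strips or discs, with large real part of a given sign on others. All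
  of these functions are built from one entire function close to \<open>1\<close> on a right half plane and close to
  \<open>0\<close> on a left half plane (\<open>entire_step\<close>). The step in turn comes from an entire function close to
  \<open>1 / z\<close> off a vertical half strip, obtained by pushing the pole of \<open>1 / z\<close> to infinity inside the strip
  (\<open>entire_reciprocal\<close>). Discs \<open>D\<close> and \<open>E\<close> of the same vertical band are told apart by \<open>exp (\<pi> z)\<close>, whose
  values at their centres have opposite signs (\<open>entire_disc_selector\<close>).

  One automorphism, composed of two shears, carries the products of sets \<open>V\<close> and \<open>D\<close> into the two corners
  where all real parts are at least \<open>r + 2\<close> or all at most \<open>- (r + 2)\<close>, and keeps the products of sets \<open>E\<close>
  in the strip where all real parts have modulus at most \<open>r\<close> (\<open>separating_automorphism\<close>). From then on
  every further automorphism is almost the identity on a strip and pushes the corners beyond a larger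
  strip (\<open>push_automorphism\<close>). With errors chosen small enough in each step the inverse compositions
  converge locally uniformly to an injective map, which misses all points that are swept to infinity
  and attains the points of the products of sets \<open>E\<close>, whose orbits under the sweeping converge (\<open>limit_of_corrections\<close>).\<close>

section \<open>Geometric convergence and an entire step function\<close>

lemma geometric_limit:
  fixes f :: "nat \<Rightarrow> 'a :: banach"
  assumes "\<And>n. n \<ge> N \<Longrightarrow> norm (f (Suc n) - f n) \<le> C * (1/2) ^ n"
  shows "f \<longlonglongrightarrow> lim f" and "\<And>n. n \<ge> N \<Longrightarrow> norm (lim f - f n) \<le> 2 * C * (1/2) ^ n"
proof -
  define d where "d n = f (Suc n) - f n" for n
  have geo: "summable (\<lambda>k. C * (1/2) ^ (k + n))" and
    geo_val: "(\<Sum>k. C * (1/2) ^ (k + n)) = 2 * C * (1/2) ^ n" for n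
  proof -
    have "(\<lambda>k. (C * (1/2) ^ n) * (1/2) ^ k) sums ((C * (1/2) ^ n) * (1 / (1 - 1/2)))"
      by (intro sums_mult geometric_sums) auto
    then have "(\<lambda>k. C * (1/2) ^ (k + n)) sums (2 * C * (1/2) ^ n)"
      by (simp add: power_add mult_ac)
    then show "summable (\<lambda>k. C * (1/2) ^ (k + n))" "(\<Sum>k. C * (1/2) ^ (k + n)) = 2 * C * (1/2) ^ n"
      by (auto simp: sums_iff)
  qed
  have bd: "norm (d (k + n)) \<le> C * (1/2) ^ (k + n)" if "n \<ge> N" for k n
    unfolding d_def using assms[of "k + n"] that by auto
  have summ: "summable (\<lambda>k. d (k + n))" if "n \<ge> N" for n
    by (rule summable_comparison_test'[OF geo[of n]]) (use bd that in auto)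
  have part: "(\<Sum>i<k. d (i + n)) = f (k + n) - f n" for k n
    by (induction k) (auto simp: d_def)
  have "(\<lambda>k. f (k + n) - f n + f n) \<longlonglongrightarrow> (\<Sum>k. d (k + n)) + f n" if "n \<ge> N" for n
    using summable_LIMSEQ[OF summ[OF that]] by (intro tendsto_add tendsto_const) (simp add: part)
  then have lim: "f \<longlonglongrightarrow> (\<Sum>k. d (k + n)) + f n" if "n \<ge> N" for n
    using that LIMSEQ_offset[of f n] by simp
  then have "convergent f"
    unfolding convergent_def by blast
  then show "f \<longlonglongrightarrow> lim f"
    by (simp only: convergent_LIMSEQ_iff)
  show "norm (lim f - f n) \<le> 2 * C * (1/2) ^ n" if "n \<ge> N" for n
  proof -
    have "lim f - f n = (\<Sum>k. d (k + n))"
      using limI[OF lim[OF that]] by simp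
    also have "norm \<dots> \<le> (\<Sum>k. C * (1/2) ^ (k + n))"
      using bd[OF that] by (intro norm_suminf_le geo) auto
    finally show ?thesis by (simp add: geo_val)
  qed
qed

lemma geometric_uniform_limit:
  fixes f :: "nat \<Rightarrow> 'b \<Rightarrow> 'a :: banach"
  assumes "\<And>n x. n \<ge> N \<Longrightarrow> x \<in> S \<Longrightarrow> norm (f (Suc n) x - f n x) \<le> C * (1/2) ^ n"
  shows "uniform_limit S f (\<lambda>x. lim (\<lambda>n. f n x)) sequentially"
proof (rule uniform_limitI)
  fix \<epsilon> :: real assume \<epsilon>: "\<epsilon> > 0"
  have "(\<lambda>n. 2 * C * (1/2::real) ^ n) \<longlonglongrightarrow> 2 * C * 0"
    by (intro tendsto_intros) auto
  then have "\<forall>\<^sub>F n in sequentially. 2 * C * (1/2::real) ^ n < \<epsilon>"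
    using \<epsilon> by (intro order_tendstoD) auto
  then show "\<forall>\<^sub>F n in sequentially. \<forall>x\<in>S. dist (f n x) (lim (\<lambda>n. f n x)) < \<epsilon>"
    using eventually_ge_at_top[of N]
  proof eventually_elim
    case (elim n)
    have "norm (lim (\<lambda>n. f n x) - f n x) \<le> 2 * C * (1/2) ^ n" if "x \<in> S" for x
      using geometric_limit(2)[of N "\<lambda>n. f n x" C n] assms that elim by blast
    then show ?case
      using elim(1) by (fastforce simp: dist_norm norm_minus_commute)
  qed
qed

text \<open>In the variable \<open>u = 1 / (z - \<i>)\<close> the function \<open>1 / z = u / (1 + \<i> u)\<close> and every polynomial in it are
  holomorphic on the unit disc, so moving the pole from \<open>0\<close> to \<open>\<i>\<close> amounts to truncating a Taylor series on \<open>\<bar>u\<bar> \<le> 1/2\<close>.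
  Truncation past the linear term keeps a factor \<open>u\<^sup>2\<close> in the error; this quadratic decay is what
  survives to infinity in the limit function below.\<close>

lemma shift_pole:
  fixes P :: "complex poly"
  assumes "e > 0"
  shows "\<exists>Q. \<forall>z. norm (z - \<i>) \<ge> 2 \<longrightarrow>
    norm (poly Q (1 / (z - \<i>)) - poly P (1 / z)) \<le> e / norm (z - \<i>) ^ 2"
proof -
  define g where "g u = poly P (u / (1 + \<i> * u))" for u
  have nz: "1 + \<i> * u \<noteq> 0" if "norm u < 1" for u
  proof
    assume "1 + \<i> * u = 0"
    then have "\<i> * u = -1" by (metis add.commute add_eq_0_iff)
    then have "norm (\<i> * u) = 1" by simp
    with that show False by (simp add: norm_mult)
  qed
  have hol: "g holomorphic_on ball 0 1"
    unfolding g_def by (intro holomorphic_intros) (use nz in auto)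
  define c where "c n = (deriv ^^ n) g 0 / fact n" for n
  have sums: "(\<lambda>n. c n * u ^ n) sums g u" if "norm u < 1" for u
    using holomorphic_power_series[OF hol, of u] that by (simp add: c_def)
  have "summable (\<lambda>n. c n * (3/4) ^ n)"
    using sums[of "3/4"] by (auto simp: sums_iff)
  then have sm: "summable (\<lambda>n. norm (c n * (1/2) ^ n))"
    by (rule powser_insidea) auto
  define t where "t n = norm (c n) * (1/2) ^ n" for n
  have sm: "summable t"
    using sm by (simp add: t_def[abs_def] norm_mult norm_power norm_divide)
  then have "(\<lambda>n. \<Sum>k. t (k + n)) \<longlonglongrightarrow> 0"
    by (rule suminf_exist_split2)
  then have "\<forall>\<^sub>F n in sequentially. (\<Sum>k. t (k + n)) < e / 4"
    using assms by (intro order_tendstoD) auto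
  then obtain N where N: "N \<ge> 2" "(\<Sum>k. t (k + N)) < e / 4"
    using eventually_conj[OF _ eventually_ge_at_top[of 2]] 
    by (metis (no_types, lifting) eventually_happens trivial_limit_sequentially)
  define Q where "Q = (\<Sum>n<N. monom (c n) n)"
  have Q: "poly Q u = (\<Sum>n<N. c n * u ^ n)" for u
    by (simp add: Q_def poly_sum poly_monom)
  have main: "norm (poly Q u - g u) \<le> e * norm u ^ 2" if u: "norm u \<le> 1/2" for u
  proof -
    have s: "(\<lambda>n. c n * u ^ n) sums g u"
      using sums u by force
    have "g u - poly Q u = (\<Sum>k. c (k + N) * u ^ (k + N))"
      using suminf_split_initial_segment[of "\<lambda>n. c n * u ^ n" N] s by (simp add: Q sums_iff)
    also have "norm \<dots> \<le> (\<Sum>k. 4 * norm u ^ 2 * t (k + N))"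
    proof (rule norm_suminf_le)
      show "norm (c (k + N) * u ^ (k + N)) \<le> 4 * norm u ^ 2 * t (k + N)" for k
      proof -
        obtain j where j: "k + N = j + 2"
          using N(1) by (metis add.commute le_Suc_ex trans_le_add2)
        have "norm u ^ j \<le> (1/2) ^ j"
          using u by (intro power_mono) auto
        then have "norm (c (j+2)) * norm u ^ j * norm u ^ 2 \<le> norm (c (j+2)) * (1/2) ^ j * norm u ^ 2"
          by (intro mult_right_mono mult_left_mono) auto
        then show ?thesis
          by (simp add: j t_def norm_mult norm_power power_add mult_ac power2_eq_square)
      qed
      show "summable (\<lambda>k. 4 * norm u ^ 2 * t (k + N))"
        by (intro summable_mult) (use sm summable_iff_shift in blast)
    qed
    also have "\<dots> = 4 * norm u ^ 2 * (\<Sum>k. t (k + N))"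
      by (intro suminf_mult) (use sm summable_iff_shift in blast)
    also have "\<dots> \<le> 4 * norm u ^ 2 * (e / 4)"
      using N by (intro mult_left_mono) auto
    finally show ?thesis by (simp add: norm_minus_commute mult_ac)
  qed
  have "norm (poly Q (1 / (z - \<i>)) - poly P (1 / z)) \<le> e / norm (z - \<i>) ^ 2"
    if z: "norm (z - \<i>) \<ge> 2" for z
  proof -
    have "z - \<i> \<noteq> 0" using z by auto
    moreover have "z \<noteq> 0" using z by auto
    moreover from \<open>z - \<i> \<noteq> 0\<close> have "1 + \<i> * (1 / (z - \<i>)) = z / (z - \<i>)"
      by (simp add: divide_eq_eq add_divide_eq_iff)
    ultimately have "1 / (z - \<i>) / (1 + \<i> * (1 / (z - \<i>))) = 1 / z"
      by simp
    then have "g (1 / (z - \<i>)) = poly P (1 / z)"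
      by (simp add: g_def)
    moreover have "norm (1 / (z - \<i>)) \<le> 1/2"
      using z by (subst norm_divide) (simp add: pos_divide_le_eq[OF order.strict_trans2[OF zero_less_numeral z]])
    ultimately show ?thesis
      using main[of "1 / (z - \<i>)"] by (simp add: norm_divide power_divide)
  qed
  then show ?thesis by blast
qed

text \<open>Pushing the pole of \<open>1 / z\<close> through \<open>\<i>, 2\<i>, 3\<i>, \<dots>\<close> leaves no pole in the limit. Points off the upper
  half strip of modulus at least \<open>2\<close> keep distance at least \<open>2\<close> from all these poles, so there
  every replacement is controlled and the errors add up to \<open>O(1 / \<bar>z\<bar>\<^sup>2)\<close>.\<close>

lemma entire_reciprocal:
  "\<exists>q. q holomorphic_on UNIV \<and>
     (\<forall>z. norm z \<ge> 2 \<longrightarrow> \<bar>Re z\<bar> \<ge> 2 \<or> Im z \<le> 0 \<longrightarrow> norm (q z - 1 / z) \<le> 2 / norm z ^ 2)"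
proof -
  \<comment> \<open>The factor \<open>(j + 2)\<^sup>2\<close> converts decay in the distance to the pole \<open>p (j + 1)\<close> into decay in \<open>\<bar>z\<bar>\<close>.\<close>
  define e :: "nat \<Rightarrow> real" where "e j = (1/2) ^ j / (real j + 2) ^ 2" for j
  have e: "e j > 0" for j by (simp add: e_def)
  obtain nxt where nxt: "\<And>j P z. norm (z - \<i>) \<ge> 2 \<Longrightarrow>
      norm (poly (nxt j P) (1 / (z - \<i>)) - poly P (1 / z)) \<le> e j / norm (z - \<i>) ^ 2"
  proof -
    have "\<forall>j P. \<exists>Q. \<forall>z. norm (z - \<i>) \<ge> 2 \<longrightarrow>
      norm (poly Q (1 / (z - \<i>)) - poly P (1 / z)) \<le> e j / norm (z - \<i>) ^ 2"
      using shift_pole[OF e] by blast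
    then have "\<exists>nxt. \<forall>j P. \<forall>z. norm (z - \<i>) \<ge> 2 \<longrightarrow>
      norm (poly (nxt j P) (1 / (z - \<i>)) - poly P (1 / z)) \<le> e j / norm (z - \<i>) ^ 2"
      by (simp only: choice_iff)
    then show thesis using that by blast
  qed
  define P where "P = rec_nat [:0, 1:] nxt"
  define p where "p j = \<i> * of_nat j" for j
  define R where "R j z = poly (P j) (1 / (z - p j))" for j z
  have R0: "R 0 z = 1 / z" for z
    by (simp add: R_def P_def p_def)
  have step: "norm (R (Suc j) z - R j z) \<le> e j / norm (z - p (Suc j)) ^ 2"
    if "norm (z - p (Suc j)) \<ge> 2" for j z
    using nxt[of "z - p j" j "P j"] that
    by (simp add: R_def P_def p_def algebra_simps)
  have step1: "norm (R (Suc j) z - R j z) \<le> 1 * (1/2) ^ j" if "norm (z - p (Suc j)) \<ge> 2" for j z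
  proof -
    have "norm (R (Suc j) z - R j z) \<le> e j / norm (z - p (Suc j)) ^ 2"
      by (rule step[OF that])
    also have "\<dots> \<le> e j / 1"
      using that e[of j] by (intro divide_left_mono) (auto simp: one_le_power)
    also have "\<dots> \<le> (1/2) ^ j / 1"
      unfolding e_def by (simp add: divide_le_eq) 
    finally show ?thesis by simp
  qed
  have step2: "norm (R (Suc j) z - R j z) \<le> (1 / norm z ^ 2) * (1/2) ^ j"
    if z: "norm (z - p (Suc j)) \<ge> 2" "z \<noteq> 0" for j z
  proof -
    let ?d = "norm (z - p (Suc j))"
    have "norm z \<le> ?d + norm (p (Suc j))"
      by (metis diff_add_cancel norm_triangle_ineq)
    also have "norm (p (Suc j)) = real j + 1"
      by (simp add: p_def norm_mult del: of_nat_Suc) 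
    also have "?d + (real j + 1) \<le> ?d * (real j + 2)"
    proof -
      have "0 \<le> (?d - 1) * (real j + 1)" using z(1) by (intro mult_nonneg_nonneg) auto
      then show ?thesis by (simp add: algebra_simps)
    qed
    finally have "norm z ^ 2 \<le> (?d * (real j + 2)) ^ 2"
      by (intro power_mono) auto
    then have "(1/2) ^ j / (?d * (real j + 2)) ^ 2 \<le> (1/2) ^ j / norm z ^ 2"
      using z by (intro divide_left_mono mult_pos_pos zero_less_power) auto
    moreover have "norm (R (Suc j) z - R j z) \<le> (1/2) ^ j / (?d * (real j + 2)) ^ 2"
      using step[OF z(1)] by (simp add: e_def power_mult_distrib mult_ac)
    ultimately show ?thesis by simp
  qed
  define q where "q z = lim (\<lambda>j. R j z)" for z
  have far: "norm (z - p j) \<ge> 2" if "norm z \<le> real N" "j \<ge> N + 2" for z N j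
  proof -
    have "norm (p j) - norm z \<le> norm (z - p j)"
      by (metis norm_minus_commute norm_triangle_ineq2)
    then show ?thesis using that by (simp add: p_def norm_mult)
  qed
  have "q holomorphic_on ball 0 (real N)" for N
  proof (rule holomorphic_uniform_sequence[OF open_ball])
    show "R (n + (N + 2)) holomorphic_on ball 0 (real N)" for n
      unfolding R_def
    proof (intro holomorphic_intros)
      fix z :: complex assume "z \<in> ball 0 (real N)"
      then have "norm (z - p (n + (N + 2))) \<ge> 2"
        by (intro far[of _ N]) auto
      then show "z - p (n + (N + 2)) \<noteq> 0" by auto
    qed
    fix x assume "x \<in> ball (0::complex) (real N)"
    then obtain d where d: "d > 0" "cball x d \<subseteq> ball 0 (real N)"
      using open_contains_cball by blast
    have "uniform_limit (cball x d) R q sequentially"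
      unfolding q_def
    proof (rule geometric_uniform_limit[of "N + 2" _ _ 1])
      fix j z assume "N + 2 \<le> j" "z \<in> cball x d"
      then show "norm (R (Suc j) z - R j z) \<le> 1 * (1/2) ^ j"
        using d(2) by (intro step1 far[of _ N]) force+
    qed
    from filterlim_compose[OF this filterlim_add_const_nat_at_top]
    have "uniform_limit (cball x d) (\<lambda>n. R (n + (N + 2))) q sequentially" .
    then show "\<exists>d>0. cball x d \<subseteq> ball 0 (real N) \<and>
        uniform_limit (cball x d) (\<lambda>n. R (n + (N + 2))) q sequentially"
      using d by blast
  qed
  then have "q holomorphic_on (\<Union>N. ball 0 (real N))"
    by (intro holomorphic_on_UN_open) auto
  also have "(\<Union>N. ball 0 (real N)) = (UNIV :: complex set)"
    using reals_Archimedean2 by auto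
  finally have hol: "q holomorphic_on UNIV" .
  have "norm (q z - 1 / z) \<le> 2 / norm z ^ 2" if z: "norm z \<ge> 2" "\<bar>Re z\<bar> \<ge> 2 \<or> Im z \<le> 0" for z
  proof -
    have "norm (z - p j) \<ge> 2" for j
      using z(2)
    proof
      assume "\<bar>Re z\<bar> \<ge> 2"
      then show ?thesis
        using abs_Re_le_cmod[of "z - p j"] by (simp add: p_def)
    next
      assume "Im z \<le> 0"
      then have "(Im z)\<^sup>2 \<le> (Im z - real j)\<^sup>2"
        by (intro abs_le_square_iff[THEN iffD1]) auto
      then have "norm z \<le> norm (z - p j)"
        by (simp add: cmod_def p_def)
      then show ?thesis using z by simp
    qed
    moreover have "z \<noteq> 0" using z by auto
    ultimately have "norm (q z - R 0 z) \<le> 2 * (1 / norm z ^ 2) * (1/2) ^ 0"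
      unfolding q_def by (intro geometric_limit(2)[of 0] step2) auto
    then show ?thesis by (simp add: R0)
  qed
  with hol show ?thesis by blast
qed

text \<open>The primitive \<open>Q\<close> of the function above behaves like a logarithm cut along the positive imaginary
  axis, and \<open>Q (- z)\<close> like one cut along the negative imaginary axis. Their difference is nearly
  constant on each side of the imaginary axis: for \<open>Re z \<ge> 2\<close> the half circle from \<open>- z\<close> down and
  around to \<open>z\<close> avoids the half strip, and along it \<open>Q\<close> gains \<open>\<i> \<pi>\<close> up to \<open>O(1 / \<bar>z\<bar>)\<close>.\<close>

lemma entire_step_unscaled:
  "\<exists>s B. s holomorphic_on UNIV \<and> B > 0 \<and>
     (\<forall>z. Re z \<ge> 2 \<longrightarrow> norm (s z - 1) \<le> B / norm z) \<and>
     (\<forall>z. Re z \<le> -2 \<longrightarrow> norm (s z) \<le> B / norm z)"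
proof -
  obtain q where q: "q holomorphic_on UNIV"
    and q_bd: "\<And>z. norm z \<ge> 2 \<Longrightarrow> \<bar>Re z\<bar> \<ge> 2 \<or> Im z \<le> 0 \<Longrightarrow> norm (q z - 1 / z) \<le> 2 / norm z ^ 2"
    using entire_reciprocal by blast
  obtain Q where Q: "\<And>z. (Q has_field_derivative q z) (at z)"
    using holomorphic_convex_primitive'[OF convex_UNIV open_UNIV q] by auto
  have main: "norm (Q z - Q (- z) - \<i> * pi) \<le> 2 * pi / norm z" if z: "Re z \<ge> 2" for z
  proof -
    define r where "r = norm z"
    define \<theta> where "\<theta> = Arg z"
    have r: "r \<ge> 2" using z complex_Re_le_cmod[of z] by (simp add: r_def)
    have z0: "z \<noteq> 0" using z by auto
    have z_eq: "z = r * exp (\<i> * \<theta>)"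
      unfolding r_def \<theta>_def using Arg_eq[OF z0] by simp
    have "\<bar>\<theta>\<bar> < pi / 2"
      using z Re_Ln_pos_lt_imp[of z] Arg_eq_Im_Ln[OF z0] unfolding \<theta>_def by auto
    then have \<theta>: "-(pi/2) < \<theta>" "\<theta> < pi/2"
      by auto
    have re: "r * cos \<theta> \<ge> 2" using z unfolding z_eq by (simp add: Re_exp)
    have outside: "\<bar>r * cos t\<bar> \<ge> 2 \<or> r * sin t \<le> 0" if t: "\<theta> - pi \<le> t" "t \<le> \<theta>" for t
    proof -
      consider "0 < t" | "- pi \<le> t" "t \<le> 0" | "t < - pi" by linarith
      then show ?thesis
      proof cases
        case 1
        then have "cos \<theta> \<le> cos t"
          using t \<theta> by (intro cos_monotone_0_pi_le) auto
        then have "r * cos t \<ge> r * cos \<theta>" using r by (intro mult_left_mono) auto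
        then show ?thesis using re by auto
      next
        case 2
        then have "sin t \<le> 0"
          using sin_ge_zero[of "-t"] by auto
        then show ?thesis using r by (auto simp: mult_nonneg_nonpos)
      next
        case 3
        then have "cos (- \<theta>) \<le> cos (- (t + pi))"
          using t \<theta> by (intro cos_monotone_0_pi_le) auto
        then have "cos \<theta> \<le> - cos t" by simp
        then have "r * cos \<theta> \<le> r * (- cos t)" using r by (intro mult_left_mono) auto
        then show ?thesis using re by auto
      qed
    qed
    \<comment> \<open>The increment of \<open>h\<close> along the half circle is the quantity to be bounded; its derivative is
      \<open>\<i> w (q w - 1 / w)\<close> at \<open>w = r exp (\<i> t)\<close>.\<close>
    define h where "h t = Q (r * exp (\<i> * t)) - \<i> * t" for t :: complex
    have "norm (h \<theta> - h (of_real (\<theta> - pi))) \<le> 2 / r * norm (of_real \<theta> - of_real (\<theta> - pi) :: complex)"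
    proof (rule field_differentiable_bound)
      fix u :: complex assume "u \<in> closed_segment (of_real (\<theta> - pi)) (of_real \<theta>)"
      then have "u \<in> of_real ` closed_segment (\<theta> - pi) \<theta>"
        by (simp only: closed_segment_of_real)
      then obtain t where t: "\<theta> - pi \<le> t" "t \<le> \<theta>" and u: "u = of_real t"
        by (auto simp: closed_segment_eq_real_ivl)
      define w where "w = r * exp (\<i> * u)"
      have nw: "norm w = r" using r by (simp add: w_def u norm_mult)
      show "(h has_field_derivative (q w * (r * (exp (\<i> * u) * \<i>)) - \<i>))
          (at u within closed_segment (of_real (\<theta> - pi)) (of_real \<theta>))"
        unfolding h_def w_def
        by (rule DERIV_subset[where s = UNIV]) (auto intro!: derivative_eq_intros DERIV_chain2[OF Q])
      have "norm (q w * (r * (exp (\<i> * u) * \<i>)) - \<i>) = norm (\<i> * w * (q w - 1 / w))"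
      proof -
        have "w \<noteq> 0" using nw r by auto
        then have "\<i> * w * (q w - 1 / w) = \<i> * w * q w - \<i>"
          by (simp add: right_diff_distrib)
        moreover have "q w * (r * (exp (\<i> * u) * \<i>)) = \<i> * w * q w"
          unfolding w_def by (simp only: mult_ac)
        ultimately show ?thesis by (simp only:)
      qed
      also have "\<dots> = r * norm (q w - 1 / w)"
        by (simp add: norm_mult nw)
      also have "\<dots> \<le> r * (2 / norm w ^ 2)"
        using outside[OF t] r nw
        by (intro mult_left_mono q_bd) (auto simp: w_def u Re_exp Im_exp)
      finally show "norm (q w * (r * (exp (\<i> * u) * \<i>)) - \<i>) \<le> 2 / r"
        using r by (simp add: nw power2_eq_square)
    qed auto
    moreover have "exp (\<i> * of_real (\<theta> - pi)) = - exp (\<i> * \<theta>)"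
      by (simp add: exp_diff right_diff_distrib)
    then have "h \<theta> - h (of_real (\<theta> - pi)) = Q z - Q (- z) - \<i> * pi"
      by (simp add: h_def z_eq algebra_simps)
    ultimately show ?thesis
      by (simp add: r_def mult_ac)
  qed
  define s where "s z = 1 / 2 + (Q z - Q (- z)) / (2 * \<i> * pi)" for z
  have Q_hol: "Q holomorphic_on A" for A
    using Q by (meson field_differentiable_at_within field_differentiable_def holomorphic_onI)
  have "(Q \<circ> uminus) holomorphic_on UNIV"
    by (intro holomorphic_on_compose Q_hol holomorphic_intros)
  then have hol: "s holomorphic_on UNIV"
    unfolding s_def by (intro holomorphic_intros Q_hol) (auto simp: o_def)
  have right: "norm (s z - 1) \<le> 1 / norm z" if "Re z \<ge> 2" for z
  proof -
    have "s z - 1 = (Q z - Q (- z) - \<i> * pi) / (2 * \<i> * pi)"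
      by (simp add: s_def field_simps)
    then have "norm (s z - 1) = norm (Q z - Q (- z) - \<i> * pi) / (2 * pi)"
      by (simp add: norm_divide norm_mult)
    also have "\<dots> \<le> (2 * pi / norm z) / (2 * pi)"
      by (intro divide_right_mono main that) auto
    finally show ?thesis by simp
  qed
  have sym: "s (- z) = 1 - s z" for z
    by (simp add: s_def field_simps)
  have left: "norm (s z) \<le> 1 / norm z" if "Re z \<le> -2" for z
    using right[of "- z"] that by (simp add: sym)
  show ?thesis
    using hol left right by (intro exI[of _ s] exI[of _ 1]) auto
qed

text \<open>Since the error of the previous step function is \<open>O(1 / \<bar>z\<bar>)\<close>, the dilation \<open>z \<mapsto> s (M z)\<close> divides it
  by \<open>M\<close> while narrowing the transition band; so one step function provides every accuracy. The decay
  along vertical lines is kept because the step will be multiplied by \<open>z\<close> later on.\<close>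

lemma entire_step:
  assumes "\<delta> > 0" "\<epsilon> > 0"
  shows "\<exists>s. s holomorphic_on UNIV \<and>
     (\<forall>z. Re z \<ge> \<delta> \<longrightarrow> norm (s z - 1) \<le> \<epsilon> / (1 + norm z)) \<and>
     (\<forall>z. Re z \<le> -\<delta> \<longrightarrow> norm (s z) \<le> \<epsilon> / (1 + norm z))"
proof -
  obtain s B where s: "s holomorphic_on UNIV" "B > 0"
    and right: "\<And>z. Re z \<ge> 2 \<Longrightarrow> norm (s z - 1) \<le> B / norm z"
    and left: "\<And>z. Re z \<le> -2 \<Longrightarrow> norm (s z) \<le> B / norm z"
    using entire_step_unscaled by blast
  define M where "M = max (2 / \<delta>) (B * (1 + 1 / \<delta>) / \<epsilon>)"
  have M: "M > 0" "M * \<delta> \<ge> 2" "B * (1 + 1 / \<delta>) \<le> \<epsilon> * M"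
  proof -
    have "2 / \<delta> \<le> M" "B * (1 + 1 / \<delta>) / \<epsilon> \<le> M" by (simp_all add: M_def)
    then show "M * \<delta> \<ge> 2" "B * (1 + 1 / \<delta>) \<le> \<epsilon> * M"
      using assms by (simp_all only: pos_divide_le_eq mult_ac)
    show "M > 0"
      using \<open>2 / \<delta> \<le> M\<close> assms by (smt (verit) divide_pos_pos)
  qed
  have est: "B / norm (M * z) \<le> \<epsilon> / (1 + norm z)" if z: "\<bar>Re z\<bar> \<ge> \<delta>" for z :: complex
  proof -
    have nz: "norm z \<ge> \<delta>" using z abs_Re_le_cmod[of z] by linarith
    have "1 + norm z \<le> (1 + 1 / \<delta>) * norm z"
      using nz assms by (simp add: field_simps)
    then have "B * (1 + norm z) \<le> B * ((1 + 1 / \<delta>) * norm z)"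
      using s(2) by (intro mult_left_mono) auto
    also have "\<dots> \<le> (\<epsilon> * M) * norm z"
      using M(3) by (metis mult.assoc mult_right_mono norm_ge_zero)
    finally have "B * (1 + norm z) \<le> \<epsilon> * (M * norm z)" by (simp add: mult_ac)
    moreover have "0 < M * norm z" using M nz assms by (intro mult_pos_pos) linarith+
    moreover have "0 < 1 + norm z" by (simp add: add_pos_nonneg)
    ultimately show ?thesis
      using M by (intro mult_imp_div_pos_le) (simp_all add: norm_mult pos_le_divide_eq)
  qed
  have re: "Re (M * z) = M * Re z" for z :: complex by simp
  have big: "M * x \<ge> 2" if "x \<ge> \<delta>" for x
    using M that mult_left_mono[of \<delta> x M] by linarith
  have "(s \<circ> (\<lambda>z. M * z)) holomorphic_on UNIV"
    by (intro holomorphic_on_compose holomorphic_intros) (use s holomorphic_on_subset in blast)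
  moreover have "norm (s (M * z) - 1) \<le> \<epsilon> / (1 + norm z)" if "Re z \<ge> \<delta>" for z :: complex
    using right[of "M * z"] est[of z] big[of "Re z"] that assms by (simp add: re)
  moreover have "norm (s (M * z)) \<le> \<epsilon> / (1 + norm z)" if "Re z \<le> -\<delta>" for z :: complex
    using left[of "M * z"] est[of z] big[of "- Re z"] that assms by (simp add: re)
  ultimately show ?thesis
    by - (rule exI[of _ "s \<circ> (*) (of_real M)"], simp)
qed

section \<open>Entire functions built from steps\<close>

text \<open>A difference of two steps, at \<open>\<plusminus> (r + 1/2)\<close>. Used as the size of a shear it fixes a vertical strip
  almost pointwise and throws both half planes beyond the strip outwards.\<close>

lemma entire_barrier:
  assumes "r \<ge> 0" "\<epsilon> > 0" "M > 0"
  shows "\<exists>g. g holomorphic_on UNIV \<and> (\<forall>z. \<bar>Re z\<bar> \<le> r \<longrightarrow> norm (g z) \<le> \<epsilon>) \<and>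
     (\<forall>z. Re z \<ge> r + 1 \<longrightarrow> Re (g z) \<ge> M) \<and> (\<forall>z. Re z \<le> - (r + 1) \<longrightarrow> Re (g z) \<le> - M)"
proof -
  define N where "N = M + 1"
  define \<eta> where "\<eta> = min \<epsilon> 1 / (2 * N)"
  have N: "N > 0" using assms by (simp add: N_def)
  have \<eta>: "\<eta> > 0" "2 * N * \<eta> \<le> \<epsilon>" "2 * N * \<eta> \<le> 1"
    using N assms by (auto simp: \<eta>_def)
  obtain s where s: "s holomorphic_on UNIV"
    and right: "\<And>z. Re z \<ge> 1/2 \<Longrightarrow> norm (s z - 1) \<le> \<eta> / (1 + norm z)"
    and left: "\<And>z. Re z \<le> -(1/2) \<Longrightarrow> norm (s z) \<le> \<eta> / (1 + norm z)"
    using entire_step[of "1/2" \<eta>] \<eta> by auto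
  have simp_bd: "\<eta> / (1 + norm z) \<le> \<eta>" for z :: complex
    using \<eta> divide_left_mono[of 1 "1 + norm z" \<eta>] by (simp add: add_pos_nonneg)
  note right = order.trans[OF right simp_bd] and left = order.trans[OF left simp_bd]
  define g where "g z = N * (s (z - (r + 1/2)) - s (- z - (r + 1/2)))" for z :: complex
  have hol: "g holomorphic_on UNIV"
    unfolding g_def
    by (intro holomorphic_intros holomorphic_on_compose[OF _ holomorphic_on_subset[OF s], unfolded o_def]) auto
  have est: "norm (g z - N * x) \<le> 2 * N * \<eta>"
    if "norm (s (z - (r + 1/2)) - x1) \<le> \<eta>" "norm (s (- z - (r + 1/2)) - x2) \<le> \<eta>" "x = x1 - x2" for z x x1 x2 :: complex
  proof -
    have "g z - N * x = N * ((s (z - (r + 1/2)) - x1) - (s (- z - (r + 1/2)) - x2))"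
      by (simp add: g_def that(3) algebra_simps)
    also have "norm \<dots> \<le> N * (\<eta> + \<eta>)"
      unfolding norm_mult using N that by (intro mult_mono norm_triangle_le_diff) auto
    finally show ?thesis by simp
  qed
  have "norm (g z) \<le> \<epsilon>" if "\<bar>Re z\<bar> \<le> r" for z
    using est[of z 0 0 0] left[of "z - (r + 1/2)"] left[of "- z - (r + 1/2)"] that \<eta> by auto
  moreover have "Re (g z) \<ge> M" if "Re z \<ge> r + 1" for z
  proof -
    have "norm (g z - of_real N * 1) \<le> 2 * N * \<eta>"
      using right[of "z - (r + 1/2)"] left[of "- z - (r + 1/2)"] that assms by (intro est[of z 1 0]) auto
    then show ?thesis
      using abs_Re_le_cmod[of "g z - of_real N * 1"] \<eta> by (simp add: N_def)
  qed
  moreover have "Re (g z) \<le> - M" if "Re z \<le> - (r + 1)" for z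
  proof -
    have "norm (g z - of_real N * (-1)) \<le> 2 * N * \<eta>"
      using left[of "z - (r + 1/2)"] right[of "- z - (r + 1/2)"] that assms by (intro est[of z 0 1]) auto
    then show ?thesis
      using abs_Re_le_cmod[of "g z - of_real N * (-1)"] \<eta> by (simp add: N_def)
  qed
  ultimately show ?thesis using hol by blast
qed

text \<open>The cubic with critical fixed points \<open>0\<close> and \<open>1\<close>. Iterating it sends the discs of radius \<open>13/50\<close>
  about these points uniformly to their centres, and it commutes with \<open>u \<mapsto> 1 - u\<close>.\<close>

definition smoothstep :: "complex \<Rightarrow> complex" where
  "smoothstep u = 3 * u ^ 2 - 2 * u ^ 3"

lemma smoothstep_funpow_reflect: "(smoothstep ^^ m) (1 - u) = 1 - (smoothstep ^^ m) u"
proof (induction m arbitrary: u)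
  case (Suc m)
  have "smoothstep (1 - v) = 1 - smoothstep v" for v
    unfolding smoothstep_def by algebra
  then show ?case using Suc by simp
qed simp

lemma smoothstep_funpow_small:
  assumes "norm u \<le> 13/50"
  shows "norm ((smoothstep ^^ m) u) \<le> (23/25) ^ m * (13/50)"
proof (induction m)
  case (Suc m)
  let ?v = "(smoothstep ^^ m) u"
  have "(23/25::real) ^ m * (13/50) \<le> 1 * (13/50)"
    by (intro mult_right_mono power_le_one) auto
  then have v: "norm ?v \<le> 13/50" using Suc by linarith
  have "smoothstep ?v = ?v * (?v * (3 - 2 * ?v))"
    by (simp add: smoothstep_def power2_eq_square power3_eq_cube algebra_simps)
  then have "norm (smoothstep ?v) = norm ?v * (norm ?v * norm (3 - 2 * ?v))"
    by (simp only: norm_mult)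
  also have "\<dots> \<le> norm ?v * (13/50 * (3 + 2 * (13/50)))"
  proof (intro mult_left_mono mult_mono)
    show "norm (3 - 2 * ?v) \<le> 3 + 2 * (13/50)"
      using norm_triangle_ineq4[of 3 "2 * ?v"] v by (simp add: norm_mult)
  qed (use v in auto)
  also have "\<dots> \<le> norm ?v * (23/25)"
    by (intro mult_left_mono) auto
  finally show ?case using Suc by simp
qed (use assms in simp)

lemma norm_exp_diff_one_le: "norm (exp z - 1) \<le> exp (norm z) - 1" for z :: complex
proof -
  have e: "(\<lambda>n. z ^ (n + 1) /\<^sub>R fact (n + 1)) sums (exp z - 1)"
    using sums_iff_shift[of "\<lambda>n. z ^ n /\<^sub>R fact n" 1 "exp z - 1"] exp_converges[of z] by simp
  have r: "(\<lambda>n. norm z ^ (n + 1) /\<^sub>R fact (n + 1)) sums (exp (norm z) - 1)"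
    using sums_iff_shift[of "\<lambda>n. norm z ^ n /\<^sub>R fact n" 1 "exp (norm z) - 1"] exp_converges[of "norm z"] by simp
  have "norm (suminf (\<lambda>n. z ^ (n + 1) /\<^sub>R fact (n + 1))) \<le> suminf (\<lambda>n. norm z ^ (n + 1) /\<^sub>R fact (n + 1))"
    by (rule norm_suminf_le) (use r in \<open>auto simp: sums_iff norm_power norm_mult simp del: power_Suc\<close>)
  then show ?thesis using e r by (simp add: sums_iff del: power_Suc)
qed

lemma exp_2_5_le: "exp (2/5 :: real) \<le> 38/25"
proof -
  have "exp (1/10 :: real) \<le> 111/100"
    using exp_bound[of "1/10"] by (simp add: power2_eq_square)
  then have "exp (1/10 :: real) ^ 4 \<le> (111/100) ^ 4"
    by (intro power_mono) auto
  also have "exp (1/10 :: real) ^ 4 = exp (2/5)"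
    by (simp flip: exp_of_nat_mult)
  finally show ?thesis by (simp add: power_divide)
qed

text \<open>The function \<open>(1 - exp (\<pi> z)) / 2\<close> is \<open>0\<close> at the points \<open>2 n \<i>\<close> and \<open>1\<close> at the points \<open>(2 n + 1) \<i>\<close>, and
  discs of radius \<open>1/8\<close> about them are mapped into the discs of radius \<open>13/50\<close> about \<open>0\<close> and \<open>1\<close>, so
  iterates of \<open>smoothstep\<close> sharpen it to an approximate indicator. Only its growth away
  from the imaginary axis is harmful. Hence \<open>z\<close> is first replaced by \<open>\<xi> z\<close>, the product of \<open>z\<close> with the approximate indicator of a vertical band: it is
  close to \<open>z\<close> in the band and, thanks to the decay of the steps, close to \<open>0\<close> off a wider band.\<close>

lemma entire_disc_selector:
  assumes "\<epsilon> > 0"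
  shows "\<exists>W. W holomorphic_on UNIV \<and>
     (\<forall>z (n::int). norm (z - 2 * of_int n * \<i>) < 1/8 \<longrightarrow> norm (W z) \<le> \<epsilon>) \<and>
     (\<forall>z (n::int). norm (z - (2 * of_int n + 1) * \<i>) < 1/8 \<longrightarrow> norm (W z - 1) \<le> \<epsilon>) \<and>
     (\<forall>z. \<bar>Re z\<bar> \<ge> 3/8 \<longrightarrow> norm (W z) \<le> \<epsilon>)"
proof -
  obtain s where s: "s holomorphic_on UNIV"
    and right: "\<And>z. Re z \<ge> 1/8 \<Longrightarrow> norm (s z - 1) \<le> (1/1000) / (1 + norm z)"
    and left: "\<And>z. Re z \<le> -(1/8) \<Longrightarrow> norm (s z) \<le> (1/1000) / (1 + norm z)"
    using entire_step[of "1/8" "1/1000"] by auto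
  define \<xi> where "\<xi> z = z * (s (z + 1/4) - s (z - 1/4))" for z
  have \<xi>_hol: "\<xi> holomorphic_on UNIV"
    unfolding \<xi>_def
    by (intro holomorphic_intros holomorphic_on_compose[OF _ holomorphic_on_subset[OF s], unfolded o_def]) auto
  have weight: "norm z * ((1/1000) / (1 + norm (z + d))) \<le> 1/1000" if "norm d \<le> 1" for z d :: complex
  proof -
    have "norm z \<le> 1 + norm (z + d)"
      using norm_triangle_ineq4[of "z + d" d] that by simp
    moreover have "1 + norm (z + d) > 0" by (simp add: add_pos_nonneg)
    ultimately show ?thesis by (simp add: divide_le_eq)
  qed
  have est: "norm (\<xi> z - z * (x1 - x2)) \<le> 1/500"
    if "norm (s (z + 1/4) - x1) \<le> (1/1000) / (1 + norm (z + 1/4))"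
       "norm (s (z - 1/4) - x2) \<le> (1/1000) / (1 + norm (z - 1/4))" for z x1 x2 :: complex
  proof -
    have "\<xi> z - z * (x1 - x2) = z * (s (z + 1/4) - x1) - z * (s (z - 1/4) - x2)"
      by (simp add: \<xi>_def algebra_simps)
    also have "norm \<dots> \<le> norm (z * (s (z + 1/4) - x1)) + norm (z * (s (z - 1/4) - x2))"
      by (rule norm_triangle_ineq4)
    also have "\<dots> \<le> norm z * ((1/1000) / (1 + norm (z + 1/4))) + norm z * ((1/1000) / (1 + norm (z + - (1/4))))"
      unfolding norm_mult using that by (intro add_mono mult_left_mono) auto
    also have "\<dots> \<le> 1/1000 + 1/1000"
      by (intro add_mono weight) auto
    finally show ?thesis by simp
  qed
  have inside: "norm (\<xi> z - z) \<le> 1/500" if "\<bar>Re z\<bar> \<le> 1/8" for z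
    using est[of z 1 0] right[of "z + 1/4"] left[of "z - 1/4"] that by auto
  have outside: "norm (\<xi> z) \<le> 1/500" if "\<bar>Re z\<bar> \<ge> 3/8" for z
  proof (cases "Re z \<ge> 0")
    case True
    then show ?thesis
      using est[of z 1 1] right[of "z + 1/4"] right[of "z - 1/4"] that by auto
  next
    case False
    then show ?thesis
      using est[of z 0 0] left[of "z + 1/4"] left[of "z - 1/4"] that by auto
  qed
  have "(\<lambda>m. (23/25::real) ^ m * (13/50)) \<longlonglongrightarrow> 0 * (13/50)"
    by (intro tendsto_intros) auto
  then have "\<forall>\<^sub>F m in sequentially. (23/25::real) ^ m * (13/50) < \<epsilon>"
    using assms by (intro order_tendstoD) auto
  then obtain m where m: "(23/25::real) ^ m * (13/50) < \<epsilon>"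
    by (meson eventually_happens trivial_limit_sequentially)
  define W where "W z = (smoothstep ^^ m) ((1 - exp (pi * \<xi> z)) / 2)" for z :: complex
  have ss: "(smoothstep ^^ k) holomorphic_on A" for k A
  proof (induction k arbitrary: A)
    case (Suc k)
    have "smoothstep holomorphic_on B" for B
      unfolding smoothstep_def[abs_def] by (intro holomorphic_intros)
    then have "(smoothstep \<circ> (smoothstep ^^ k)) holomorphic_on A"
      by (intro holomorphic_on_compose Suc)
    then show ?case by (simp add: o_def)
  qed (simp add: id_def)
  have W_hol: "W holomorphic_on UNIV"
    unfolding W_def
    by (intro holomorphic_on_compose[OF _ ss, unfolded o_def] holomorphic_intros \<xi>_hol) auto
  \<comment> \<open>The radius is \<open>1/8\<close> of the discs plus the error \<open>1/500\<close> of \<open>\<xi>\<close>; times \<open>\<pi>\<close> it is below \<open>2/5\<close>.\<close>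
  have key: "norm ((smoothstep ^^ m) ((1 - exp (pi * w)) / 2)) \<le> \<epsilon>" if w: "norm w \<le> 127/1000" for w :: complex
  proof -
    have "norm (of_real pi * w) \<le> 3.1416 * (127/1000)"
      unfolding norm_mult using w pi_approx by (intro mult_mono) auto
    then have "exp (norm (of_real pi * w)) \<le> exp (2/5)"
      by simp
    then have "norm (exp (pi * w) - 1) \<le> 13/25"
      using norm_exp_diff_one_le[of "pi * w"] exp_2_5_le by linarith
    then have "norm ((1 - exp (pi * w)) / 2) \<le> 13/50"
      by (simp add: norm_divide norm_minus_commute)
    from smoothstep_funpow_small[OF this, of m] m show ?thesis by linarith
  qed
  have D: "norm (W z) \<le> \<epsilon>" if z: "norm (z - 2 * of_int n * \<i>) < 1/8" for z n
  proof -
    define w where "w = \<xi> z - 2 * of_int n * \<i>"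
    have "\<bar>Re z\<bar> \<le> 1/8" using z abs_Re_le_cmod[of "z - 2 * of_int n * \<i>"] by simp
    from inside[OF this] have "norm w \<le> 127/1000"
      using z norm_triangle_ineq[of "\<xi> z - z" "z - 2 * of_int n * \<i>"] by (simp add: w_def)
    moreover have "pi * \<xi> z = pi * w + 2 * pi * \<i> * of_int n"
      by (simp add: w_def algebra_simps)
    then have "exp (pi * \<xi> z) = exp (pi * w)"
      using exp_integer_2pi[of "of_int n"] by (simp add: exp_add mult_ac)
    ultimately show ?thesis
      using key[of w] by (simp add: W_def)
  qed
  have E: "norm (W z - 1) \<le> \<epsilon>" if z: "norm (z - (2 * of_int n + 1) * \<i>) < 1/8" for z n
  proof -
    define w where "w = \<xi> z - (2 * of_int n + 1) * \<i>"
    have "\<bar>Re z\<bar> \<le> 1/8" using z abs_Re_le_cmod[of "z - (2 * of_int n + 1) * \<i>"] by simp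
    from inside[OF this] have w: "norm w \<le> 127/1000"
      using z norm_triangle_ineq[of "\<xi> z - z" "z - (2 * of_int n + 1) * \<i>"] by (simp add: w_def)
    have "pi * \<xi> z = pi * w + 2 * pi * \<i> * of_int n + pi * \<i>"
      by (simp add: w_def algebra_simps)
    then have "exp (pi * \<xi> z) = - exp (pi * w)"
      using exp_integer_2pi[of "of_int n"] by (simp add: exp_add mult_ac)
    then have "(1 - exp (pi * \<xi> z)) / 2 = 1 - (1 - exp (pi * w)) / 2"
      by (simp add: field_simps)
    then have "W z - 1 = - (smoothstep ^^ m) ((1 - exp (pi * w)) / 2)"
      by (simp only: W_def smoothstep_funpow_reflect) simp
    then show ?thesis
      using key[OF w] by simp
  qed
  have "norm (W z) \<le> \<epsilon>" if "\<bar>Re z\<bar> \<ge> 3/8" for z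
    unfolding W_def using outside[OF that] by (intro key) auto
  with W_hol D E show ?thesis by blast
qed

section \<open>Separating the discs and bands\<close>

lemma c_centre_separated:
  assumes "a > 0" "l \<noteq> l'" "l \<noteq> 0" "l' \<noteq> 0"
  shows "\<bar>c_centre a l - c_centre a l'\<bar> \<ge> 1"
proof -
  have "real_of_int l - real_of_int l' \<ge> 1 \<or> real_of_int l' - real_of_int l \<ge> 1"
    using assms(2) by linarith
  moreover have "real_of_int l \<ge> 1 \<or> real_of_int l \<le> -1" "real_of_int l' \<ge> 1 \<or> real_of_int l' \<le> -1"
    using assms by linarith+
  ultimately show ?thesis
    using assms(1) unfolding c_centre_def by (auto simp: field_simps abs_if split: if_splits)
qed

lemma V_set_off_centres:
  assumes "a > 0" "1 \<le> \<bar>l\<bar>" "\<bar>l\<bar> \<le> K + 1" "1 \<le> \<bar>l'\<bar>" "\<bar>l'\<bar> \<le> K + 1" "z \<in> V_set a K l"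
  shows "\<bar>Re z - c_centre a l'\<bar> \<ge> 1/2"
proof -
  define x y k where "x = real_of_int l" and "y = real_of_int l'" and "k = real_of_int K"
  have "l' + 1 \<le> l \<or> l' = l \<or> l + 1 \<le> l'" by linarith
  then have xy: "y + 1 \<le> x \<or> y = x \<or> x + 1 \<le> y"
    unfolding x_def y_def by (metis of_int_1 of_int_add of_int_le_iff)
  have sgn: "1 \<le> l' \<or> l' \<le> - 1" using assms by linarith
  then have y: "1 \<le> y \<and> c_centre a l' = a + (4 * y - 3) / 2 \<or> y \<le> - 1 \<and> c_centre a l' = - (a + (- 4 * y - 3) / 2)"
    unfolding y_def c_centre_def by auto
  have "real_of_int (- (K + 1)) \<le> real_of_int l'" "real_of_int l' \<le> real_of_int (K + 1)"
    unfolding of_int_le_iff using assms by linarith+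
  then have yk: "- (k + 1) \<le> y" "y \<le> k + 1" unfolding y_def k_def by simp_all
  have "1 \<le> x \<and> a + (2 * x - 1) \<le> Re z \<and> Re z \<le> a + 2 * x \<or> x = k + 1 \<and> a + 2 * k + 1 \<le> Re z \<or>
      x \<le> - 1 \<and> - (a - 2 * x) \<le> Re z \<and> Re z \<le> - (a - 2 * x - 1) \<or> x = - (k + 1) \<and> Re z \<le> - (a + 2 * k + 1)"
    using assms(2,6) unfolding V_set_def x_def k_def by (auto split: if_splits)
  then show ?thesis
    using xy y yk assms(1) by (elim disjE conjE) (simp_all add: abs_if field_simps)
qed

lemma V_set_side:
  assumes "a > 0" "1 \<le> \<bar>l\<bar>" "\<bar>l\<bar> \<le> K + 1" "z \<in> V_set a K l"
  shows "of_int (sgn l) * Re z \<ge> a"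
proof -
  have "real_of_int l \<ge> 1 \<or> real_of_int l \<le> -1"
    using assms by linarith
  then show ?thesis
    using assms unfolding V_set_def by (auto simp: field_simps abs_if split: if_splits)
qed

lemma c_centre_side:
  assumes "a > 0" "l \<noteq> 0"
  shows "of_int (sgn l) * c_centre a l \<ge> a + 1/2"
proof -
  have "real_of_int l \<ge> 1 \<or> real_of_int l \<le> -1"
    using assms by linarith
  then show ?thesis
    using assms unfolding c_centre_def by (auto simp: field_simps abs_if split: if_splits)
qed

lemma abs_c_centre_le:
  assumes "a > 0" "1 \<le> \<bar>l\<bar>" "\<bar>l\<bar> \<le> K + 1"
  shows "\<bar>c_centre a l\<bar> \<le> a + 2 * K + 1/2"
proof -
  have "real_of_int \<bar>l\<bar> \<ge> 1" "real_of_int \<bar>l\<bar> \<le> real_of_int K + 1"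
    using assms by linarith+
  then show ?thesis
    using assms unfolding c_centre_def by (auto simp: field_simps abs_if split: if_splits)
qed

lemma D_setE:
  assumes "z \<in> D_set a l"
  obtains n :: int where "norm (z - c_centre a l - 2 * of_int n * \<i>) < 1/8"
  using assms by (auto simp: D_set_def D_disc_def dist_norm norm_minus_commute diff_diff_eq)

lemma E_setE:
  assumes "z \<in> E_set a l"
  obtains n :: int where "norm (z - c_centre a l - (2 * of_int n + 1) * \<i>) < 1/8"
  using assms by (auto simp: E_set_def E_disc_def dist_norm norm_minus_commute diff_diff_eq)

lemma Re_near_c_centre:
  assumes "z \<in> D_set a l \<union> E_set a l"
  shows "\<bar>Re z - c_centre a l\<bar> \<le> 1/8"
proof -
  have "\<bar>Re z - c_centre a l\<bar> \<le> 1/8" if "norm (z - c_centre a l - of_real t * \<i>) < 1/8" for t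
    using abs_Re_le_cmod[of "z - c_centre a l - of_real t * \<i>"] that by simp
  from this[of "2 * of_int _"] this[of "2 * of_int _ + 1"] show ?thesis
    using assms by (auto elim!: D_setE E_setE)
qed

text \<open>An odd step at the imaginary axis has the right sign on all the bands and discs. From it the
  approximate indicators of the families \<open>E\<close> are subtracted, with the sign of their side, which cancels
  the step there and changes little elsewhere: each selector is small on the discs \<open>D\<close> of its own column
  and at horizontal distance at least \<open>3/8\<close> from its centres, where all the other columns and bands lie.\<close>

lemma entire_separator:
  assumes "a > 0" "K \<ge> 1" "M > 0"
  shows "\<exists>f. f holomorphic_on UNIV \<and>
    (\<forall>l z. 1 \<le> \<bar>l\<bar> \<and> \<bar>l\<bar> \<le> K + 1 \<longrightarrow>
       (z \<in> V_set a K l \<union> D_set a l \<longrightarrow> of_int (sgn l) * Re (f z) \<ge> M) \<and>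
       (z \<in> E_set a l \<longrightarrow> \<bar>Re (f z)\<bar> \<le> 1))"
proof -
  define I where "I = {l. 1 \<le> \<bar>l\<bar> \<and> \<bar>l\<bar> \<le> K + 1}"
  have "I \<subseteq> {- (K + 1)..K + 1}" by (auto simp: I_def)
  then have fin: "finite I" using finite_subset by blast
  define N where "N = M + 1"
  \<comment> \<open>Two step errors and one selector error for each column, multiplied by \<open>N\<close>, must total \<open>1\<close>.\<close>
  define \<eta> where "\<eta> = 1 / (N * (2 + card I))"
  have N: "N > 0" using assms by (simp add: N_def)
  have \<eta>: "\<eta> > 0" "N * (2 * \<eta> + card I * \<eta>) = 1"
  proof -
    have pos: "N * (2 + card I) > 0" using N by (intro mult_pos_pos) auto
    then show "\<eta> > 0" by (simp add: \<eta>_def)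
    have "N * (2 * \<eta> + card I * \<eta>) = N * (2 + card I) * \<eta>" by (simp add: algebra_simps)
    also have "\<dots> = 1" using pos unfolding \<eta>_def by (metis less_irrefl nonzero_eq_divide_eq mult.commute)
    finally show "N * (2 * \<eta> + card I * \<eta>) = 1" .
  qed
  obtain s where s: "s holomorphic_on UNIV"
    and right': "\<And>z. Re z \<ge> a/2 \<Longrightarrow> norm (s z - 1) \<le> \<eta> / (1 + norm z)"
    and left': "\<And>z. Re z \<le> -(a/2) \<Longrightarrow> norm (s z) \<le> \<eta> / (1 + norm z)"
    using entire_step[of "a/2" \<eta>] \<eta> assms by auto
  have simp_bd: "\<eta> / (1 + norm z) \<le> \<eta>" for z :: complex
    using \<eta> divide_left_mono[of 1 "1 + norm z" \<eta>] by (simp add: add_pos_nonneg)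
  note right = order.trans[OF right' simp_bd] and left = order.trans[OF left' simp_bd]
  obtain W where W: "W holomorphic_on UNIV"
    and W_D: "\<And>z (n::int). norm (z - 2 * of_int n * \<i>) < 1/8 \<Longrightarrow> norm (W z) \<le> \<eta>"
    and W_E: "\<And>z (n::int). norm (z - (2 * of_int n + 1) * \<i>) < 1/8 \<Longrightarrow> norm (W z - 1) \<le> \<eta>"
    and W_far: "\<And>z. \<bar>Re z\<bar> \<ge> 3/8 \<Longrightarrow> norm (W z) \<le> \<eta>"
    using entire_disc_selector[OF \<eta>(1)] by blast
  define f where "f z = N * (s z - s (- z) - (\<Sum>l\<in>I. of_int (sgn l) * W (z - c_centre a l)))" for z :: complex
  have hol: "f holomorphic_on UNIV"
    unfolding f_def
    by (intro holomorphic_intros holomorphic_on_compose[OF _ holomorphic_on_subset[OF s], unfolded o_def]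
        holomorphic_on_compose[OF _ holomorphic_on_subset[OF W], unfolded o_def]) auto
  \<comment> \<open>\<open>\<omega>\<close> holds the values that the selectors approximate at \<open>z\<close>.\<close>
  have est: "norm (f z - N * (of_int (sgn l) - (\<Sum>l'\<in>I. of_int (sgn l') * \<omega> l'))) \<le> 1"
    if l: "l \<in> I" and side: "of_int (sgn l) * Re z \<ge> a/2"
      and \<omega>: "\<And>l'. l' \<in> I \<Longrightarrow> norm (W (z - c_centre a l') - \<omega> l') \<le> \<eta>" for z :: complex and l and \<omega> :: "int \<Rightarrow> complex"
  proof -
    define A where "A = s z - s (- z) - of_int (sgn l)"
    define B where "B = (\<Sum>l'\<in>I. of_int (sgn l') * (W (z - c_centre a l') - \<omega> l'))"
    have "f z - N * (of_int (sgn l) - (\<Sum>l'\<in>I. of_int (sgn l') * \<omega> l')) = N * (A - B)"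
      by (simp add: f_def A_def B_def algebra_simps sum_subtractf)
    moreover have "norm A \<le> 2 * \<eta>"
    proof (cases "l > 0")
      case True
      then have "A = (s z - 1) - s (- z)" by (simp add: A_def)
      also have "norm \<dots> \<le> \<eta> + \<eta>"
        using True side by (intro norm_triangle_le_diff add_mono right left) auto
      finally show ?thesis by simp
    next
      case False
      then have "A = s z - (s (- z) - 1)" and "l < 0" using l by (auto simp: A_def I_def)
      moreover have "norm (s z - (s (- z) - 1)) \<le> \<eta> + \<eta>"
        using \<open>l < 0\<close> side by (intro norm_triangle_le_diff add_mono right left) auto
      ultimately show ?thesis by simp
    qed
    moreover have "norm B \<le> card I * \<eta>"
      unfolding B_def
    proof (rule sum_norm_bound)
      fix l' assume "l' \<in> I"
      then show "norm (of_int (sgn l') * (W (z - c_centre a l') - \<omega> l')) \<le> \<eta>"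
        using \<omega>[of l'] by (auto simp: norm_mult sgn_if I_def)
    qed
    ultimately have "norm (f z - N * (of_int (sgn l) - (\<Sum>l'\<in>I. of_int (sgn l') * \<omega> l'))) \<le> N * (2 * \<eta> + card I * \<eta>)"
      unfolding norm_mult using N by (simp add: norm_mult norm_triangle_le_diff)
    then show ?thesis by (simp only: \<eta>)
  qed
  have outer: "norm (W (z - c_centre a l')) \<le> \<eta>"
    if "z \<in> D_set a l \<union> E_set a l" "l \<in> I" "l' \<in> I" "l' \<noteq> l" for z :: complex and l l'
  proof (rule W_far)
    show "3/8 \<le> \<bar>Re (z - complex_of_real (c_centre a l'))\<bar>"
    proof -
      have "1 \<le> \<bar>c_centre a l - c_centre a l'\<bar>"
        using that assms by (intro c_centre_separated) (auto simp: I_def)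
      then show ?thesis
        using Re_near_c_centre[OF that(1)] by (simp only: minus_complex.simps Re_complex_of_real)
    qed
  qed
  have side: "of_int (sgn l) * Re z \<ge> a / 2" if "z \<in> D_set a l \<union> E_set a l" "l \<in> I" for z :: complex and l
  proof -
    have l: "l \<noteq> 0" using that(2) by (auto simp: I_def)
    note near = Re_near_c_centre[OF that(1), unfolded abs_le_iff]
    show ?thesis
    proof (cases "l > 0")
      case True
      then show ?thesis
        using near c_centre_side[OF assms(1) l] assms(1) by simp
    next
      case False
      then show ?thesis
        using l near c_centre_side[OF assms(1) l] assms(1) by simp
    qed
  qed
  have avoid: "of_int (sgn l) * Re (f z) \<ge> M" if l: "l \<in> I" and z: "z \<in> V_set a K l \<union> D_set a l" for l and z :: complex
  proof -
    have "norm (W (z - c_centre a l')) \<le> \<eta>" if l': "l' \<in> I" for l'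
    proof (cases "z \<in> V_set a K l")
      case True
      show ?thesis
        by (rule W_far) (use V_set_off_centres[of a l K l' z] True l l' assms in \<open>auto simp: I_def\<close>)
    next
      case False
      with z have D: "z \<in> D_set a l" by simp
      show ?thesis
      proof (cases "l' = l")
        case True
        then show ?thesis using D W_D by (auto elim!: D_setE)
      next
        case False
        then show ?thesis using outer D l l' by auto
      qed
    qed
    moreover have "of_int (sgn l) * Re z \<ge> a / 2"
      using z side[of z l] V_set_side[of a l K z] l assms by (auto simp: I_def)
    ultimately have "norm (f z - of_real N * of_int (sgn l)) \<le> 1"
      using l est[of l z "\<lambda>_. 0"] by simp
    then have "\<bar>Re (f z) - N * of_int (sgn l)\<bar> \<le> 1"
      using abs_Re_le_cmod[of "f z - of_real N * of_int (sgn l)"] by simp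
    then show ?thesis
      using l by (cases "l > 0") (auto simp: I_def N_def sgn_if)
  qed
  have keep: "\<bar>Re (f z)\<bar> \<le> 1" if l: "l \<in> I" and z: "z \<in> E_set a l" for l and z :: complex
  proof -
    have "norm (W (z - c_centre a l') - (if l' = l then 1 else 0)) \<le> \<eta>" if l': "l' \<in> I" for l'
      using z W_E outer[of z l l'] l l' by (auto elim!: E_setE)
    then have "norm (f z - of_real N * (of_int (sgn l) -
        (\<Sum>l'\<in>I. of_int (sgn l') * (if l' = l then 1 else 0)))) \<le> 1"
      using l side[of z l] z est[of l z "\<lambda>l'. if l' = l then 1 else 0"] by blast
    moreover have "(\<Sum>l'\<in>I. of_int (sgn l') * (if l' = l then 1 else 0)) = (of_int (sgn l) :: complex)"
      using fin l by (simp add: if_distrib cong: if_cong)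
    ultimately show ?thesis
      using abs_Re_le_cmod[of "f z"] by simp
  qed
  show ?thesis
    using hol avoid keep by (intro exI[of _ f]) (auto simp: I_def)
qed

section \<open>Holomorphic maps and shears\<close>

lemma bounded_linear_axis: "bounded_linear (\<lambda>t. axis j t :: complex ^ 'k)"
proof -
  have "linear (\<lambda>t. axis j t :: complex ^ 'k)"
    by (rule linearI) (auto simp: vec_eq_iff axis_def)
  then show ?thesis by (rule linear_conv_bounded_linear[THEN iffD1])
qed

lemma norm_axis: "norm (axis i x :: complex ^ 'k) = norm x"
  by (simp add: norm_eq_sqrt_inner inner_axis_axis)

lemma line_has_derivative:
  fixes F :: "complex ^ 'k \<Rightarrow> complex ^ 'm"
  assumes "(F has_derivative (\<lambda>h. A *v h)) (at (z + axis j t))"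
  shows "((\<lambda>t. F (z + axis j t) $ i) has_field_derivative A $ i $ j) (at t)"
proof -
  have ax: "((\<lambda>t. z + axis j t) has_derivative (\<lambda>h. axis j h)) (at t)"
    by (auto intro!: derivative_eq_intros bounded_linear_imp_has_derivative bounded_linear_axis)
  have "((\<lambda>t. F (z + axis j t)) has_derivative (\<lambda>h. A *v axis j h)) (at t)"
    using has_derivative_compose[OF ax assms] .
  then have "((\<lambda>t. F (z + axis j t) $ i) has_derivative (\<lambda>h. (A *v axis j h) $ i)) (at t)"
    by (rule bounded_linear.has_derivative[OF bounded_linear_vec_nth])
  moreover have "(A *v axis j h) $ i = A $ i $ j * h" for h
    by (simp add: matrix_vector_mult_def axis_def if_distrib cong: if_cong)
  ultimately show ?thesis
    by (simp add: has_field_derivative_def)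
qed

lemma complex_jacobian_eq:
  fixes F :: "complex ^ 'k \<Rightarrow> complex ^ 'm"
  assumes "(F has_derivative (\<lambda>h. A *v h)) (at z)"
  shows "complex_jacobian F z = A"
proof -
  have axis_0: "axis j 0 = (0 :: complex ^ 'k)" for j
    by simp
  have "deriv (\<lambda>t. F (z + axis j t) $ i) 0 = A $ i $ j" for i j
    using DERIV_imp_deriv[OF line_has_derivative[of F A z j 0 i, unfolded axis_0 add_0_right]] assms by blast
  then show ?thesis by (simp add: complex_jacobian_def vec_eq_iff)
qed

lemma holomorphic_map_has_derivative:
  assumes "holomorphic_map F"
  shows "(F has_derivative (\<lambda>h. complex_jacobian F z *v h)) (at z)"
  using assms complex_jacobian_eq unfolding holomorphic_map_def by metis

lemma holomorphic_map_continuous: "holomorphic_map F \<Longrightarrow> continuous_on A F"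
  by (meson continuous_at_imp_continuous_on has_derivative_continuous holomorphic_map_has_derivative)

lemma holomorphic_map_comp:
  assumes "holomorphic_map F" "holomorphic_map G"
  shows "holomorphic_map (F \<circ> G)"
    and "complex_jacobian (F \<circ> G) z = complex_jacobian F (G z) ** complex_jacobian G z"
proof -
  have *: "(F \<circ> G has_derivative (\<lambda>h. (complex_jacobian F (G z) ** complex_jacobian G z) *v h)) (at z)" for z
    using diff_chain_at[OF holomorphic_map_has_derivative[OF assms(2)] holomorphic_map_has_derivative[OF assms(1)]]
    by (simp add: o_def matrix_vector_mul_assoc)
  show "holomorphic_map (F \<circ> G)"
    unfolding holomorphic_map_def using * by blast
  show "complex_jacobian (F \<circ> G) z = complex_jacobian F (G z) ** complex_jacobian G z"
    by (rule complex_jacobian_eq[OF *])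
qed

definition vp_automorphism :: "(complex ^ 'k \<Rightarrow> complex ^ 'k) \<Rightarrow> bool" where
  "vp_automorphism F \<longleftrightarrow> bij F \<and> holomorphic_map F \<and> holomorphic_map (inv F) \<and> volume_preserving F"

lemma vp_automorphism_comp:
  assumes "vp_automorphism F" "vp_automorphism G"
  shows "vp_automorphism (F \<circ> G)"
  using assms
  by (auto simp: vp_automorphism_def o_inv_distrib volume_preserving_def det_mul bij_comp
      intro: holomorphic_map_comp simp: holomorphic_map_comp(2))

definition shear :: "'k \<Rightarrow> complex ^ 'k \<Rightarrow> (complex \<Rightarrow> complex) \<Rightarrow> complex ^ 'k \<Rightarrow> complex ^ 'k" where
  "shear i v f z = z + f (z $ i) *s v"

lemma shear_inverse: "v $ i = 0 \<Longrightarrow> shear i v f (shear i v (\<lambda>x. - f x) z) = z"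
  by (simp add: shear_def vec_eq_iff)

lemma inv_shear: 
  assumes "v $ i = 0"
  shows "bij (shear i v f)" "inv (shear i v f) = shear i v (\<lambda>x. - f x)"
proof -
  have 1: "shear i v f (shear i v (\<lambda>x. - f x) z) = z" for z
    by (rule shear_inverse[OF assms])
  have 2: "shear i v (\<lambda>x. - f x) (shear i v f z) = z" for z
    using shear_inverse[OF assms, of "\<lambda>x. - f x"] by simp
  show "bij (shear i v f)"
    using 1 2 by (metis bijI')
  show "inv (shear i v f) = shear i v (\<lambda>x. - f x)"
    using 1 2 by (intro inv_equality) auto
qed

lemma shear_jacobian:
  fixes v :: "complex ^ 'k"
  assumes v: "v $ i = 0" and f: "f holomorphic_on UNIV"
  shows "holomorphic_map (shear i v f)" "volume_preserving (shear i v f)"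
proof -
  define A :: "complex ^ 'k \<Rightarrow> complex ^ 'k ^ 'k" where
    "A z = (\<chi> p q. if q = i then (mat 1 *v (axis i 1 + deriv f (z $ i) *s v)) $ p else mat 1 $ p $ q)" for z
  have A_apply: "A z *v h = h + (deriv f (z $ i) * h $ i) *s v" for z h
  proof -
    have "(\<Sum>q\<in>UNIV. A z $ p $ q * h $ q) = (\<Sum>q\<in>UNIV. (if q = p then h $ p else 0) + (if q = i then deriv f (z $ i) * v $ p * h $ i else 0))" for p
      by (intro sum.cong) (use v in \<open>auto simp: A_def matrix_vector_mul_lid, auto simp: mat_def axis_def\<close>)
    then have "(\<Sum>q\<in>UNIV. A z $ p $ q * h $ q) = h $ p + deriv f (z $ i) * v $ p * h $ i" for p
      by (simp add: sum.distrib)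
    then show ?thesis
      by (simp add: vec_eq_iff matrix_vector_mult_def mult_ac)
  qed
  have D: "(shear i v f has_derivative (\<lambda>h. A z *v h)) (at z)" for z
  proof -
    have "(f has_field_derivative deriv f (z $ i)) (at (z $ i))"
      using f by (simp add: holomorphic_derivI)
    then have f': "(f has_derivative (\<lambda>h. deriv f (z $ i) * h)) (at (z $ i))"
      by (simp add: has_field_derivative_def)
    have nth: "((\<lambda>z. z $ i) has_derivative (\<lambda>h. h $ i)) (at z)"
      by (intro bounded_linear_imp_has_derivative bounded_linear_vec_nth)
    have "linear (\<lambda>c. c *s v)"
      by (rule linearI) (auto simp: vec_eq_iff algebra_simps)
    then have bl: "bounded_linear (\<lambda>c. c *s v)"
      by (rule linear_conv_bounded_linear[THEN iffD1])
    have "((\<lambda>z. f (z $ i) *s v) has_derivative (\<lambda>h. (deriv f (z $ i) * h $ i) *s v)) (at z)"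
      by (rule bounded_linear.has_derivative[OF bl has_derivative_compose[OF nth f']])
    then show ?thesis
      unfolding shear_def A_apply by (intro has_derivative_add has_derivative_ident)
  qed
  show "holomorphic_map (shear i v f)"
    unfolding holomorphic_map_def using D by blast
  \<comment> \<open>\<open>A z\<close> is the identity with column \<open>i\<close> replaced by a vector whose \<open>i\<close>-th entry is \<open>1\<close>, as \<open>v $ i = 0\<close>;
    its determinant is that entry by Cramer's rule.\<close>
  have "det (A z) = 1" for z
    unfolding A_def by (subst cramer_lemma) (simp add: v axis_def)
  then show "volume_preserving (shear i v f)"
    by (simp add: volume_preserving_def complex_jacobian_eq[OF D])
qed

lemma shear_automorphism:
  assumes "v $ i = 0" "f holomorphic_on UNIV"
  shows "vp_automorphism (shear i v f)"
  using assms unfolding vp_automorphism_def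
  by (simp add: inv_shear shear_jacobian holomorphic_on_minus)

section \<open>Locally uniform limits of holomorphic maps\<close>

lemma norm_le_sum_components: "norm z \<le> (\<Sum>i\<in>UNIV. norm (z $ i))" for z :: "complex ^ 'k"
  unfolding norm_vec_def by (rule L2_set_le_sum) auto

lemma norm_le_card_times:
  fixes z :: "complex ^ 'k" and B :: real
  assumes "\<And>i. norm (z $ i) \<le> B"
  shows "norm z \<le> CARD('k) * B"
  using norm_le_sum_components[of z] sum_bounded_above[of UNIV "\<lambda>i. norm (z $ i)" B] assms by simp

text \<open>Cauchy's inequality on the unit discs in the coordinate directions turns uniform convergence of the
  maps into uniform convergence of their Jacobian matrices, and then the limit may be differentiated
  termwise.\<close>

lemma holomorphic_map_limit:
  fixes f :: "nat \<Rightarrow> complex ^ 'k \<Rightarrow> complex ^ 'k"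
  assumes hol: "\<And>n. holomorphic_map (f n)"
    and lim: "\<And>R. uniform_limit (cball 0 R) f F sequentially"
  shows "holomorphic_map F" "(\<lambda>n. complex_jacobian (f n) z) \<longlonglongrightarrow> complex_jacobian F z"
proof -
  have line_hol: "(\<lambda>t. f n (z + axis j t) $ i) holomorphic_on A" for n z i j A
    using line_has_derivative[OF holomorphic_map_has_derivative[OF hol]]
    by (meson field_differentiable_at_within field_differentiable_def holomorphic_onI)
  have small: "norm (z + axis j t) \<le> norm z + 1" if "t \<in> cball 0 1" for z :: "complex ^ 'k" and t j
    using norm_triangle_ineq[of z "axis j t"] that by (simp add: norm_axis)
  have line_lim: "uniform_limit (cball 0 1) (\<lambda>n t. f n (z + axis j t) $ i) (\<lambda>t. F (z + axis j t) $ i) sequentially" for z i j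
  proof (rule uniform_limitI)
    fix e :: real assume "e > 0"
    then have "\<forall>\<^sub>F n in sequentially. \<forall>x\<in>cball 0 (norm z + 1). dist (f n x) (F x) < e"
      using lim uniform_limitD by blast
    then show "\<forall>\<^sub>F n in sequentially. \<forall>t\<in>cball 0 1. dist (f n (z + axis j t) $ i) (F (z + axis j t) $ i) < e"
    proof eventually_elim
      case (elim n)
      show ?case
        using elim small[of _ z j] by (auto intro: le_less_trans[OF dist_vec_nth_le])
    qed
  qed
  have F_line: "continuous_on (cball 0 1) (\<lambda>t. F (z + axis j t) $ i)" "(\<lambda>t. F (z + axis j t) $ i) holomorphic_on ball 0 1" for z i j
  proof -
    have "\<forall>\<^sub>F n in sequentially. continuous_on (cball 0 1) (\<lambda>t. f n (z + axis j t) $ i) \<and> (\<lambda>t. f n (z + axis j t) $ i) holomorphic_on ball 0 1"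
      using line_hol holomorphic_on_imp_continuous_on by (intro always_eventually) blast
    from holomorphic_uniform_limit[OF this line_lim]
    show "continuous_on (cball 0 1) (\<lambda>t. F (z + axis j t) $ i)" "(\<lambda>t. F (z + axis j t) $ i) holomorphic_on ball 0 1"
      by auto
  qed
  have jac: "norm (complex_jacobian (f n) z $ i $ j - complex_jacobian F z $ i $ j) \<le> e"
    if e: "\<And>x. norm x \<le> norm z + 1 \<Longrightarrow> norm (f n x - F x) \<le> e" for n z i j e
  proof -
    define g where "g t = f n (z + axis j t) $ i - F (z + axis j t) $ i" for t
    have "norm ((deriv ^^ 1) g 0) \<le> fact 1 * e / 1 ^ 1"
    proof (rule Cauchy_inequality)
      show "g holomorphic_on ball 0 1"
        unfolding g_def by (intro holomorphic_intros line_hol F_line)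
      show "continuous_on (cball 0 1) g"
        unfolding g_def by (intro continuous_intros holomorphic_on_imp_continuous_on line_hol F_line)
      fix t :: complex assume "norm (0 - t) = 1"
      then have "norm (f n (z + axis j t) - F (z + axis j t)) \<le> e"
        by (intro e small) auto
      then show "norm (g t) \<le> e"
        unfolding g_def using Finite_Cartesian_Product.norm_nth_le[of "f n (z + axis j t) - F (z + axis j t)" i] by simp
    qed auto
    moreover have "deriv g 0 = complex_jacobian (f n) z $ i $ j - complex_jacobian F z $ i $ j"
      unfolding g_def complex_jacobian_def vec_lambda_beta
      by (intro deriv_diff holomorphic_on_imp_differentiable_at[of _ "ball 0 1"] line_hol F_line) auto
    ultimately show ?thesis by simp
  qed
  have jac_ev: "\<forall>\<^sub>F n in sequentially. \<forall>z\<in>cball 0 R. \<forall>i j. norm (complex_jacobian (f n) z $ i $ j - complex_jacobian F z $ i $ j) \<le> e"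
    if "e > 0" for e R
    using uniform_limitD[OF lim[of "R + 1"] \<open>e > 0\<close>]
  proof eventually_elim
    case (elim n)
    show ?case
      by (intro ballI allI jac) (use elim in \<open>force simp: dist_norm intro: less_imp_le\<close>)
  qed
  show "(\<lambda>n. complex_jacobian (f n) z) \<longlonglongrightarrow> complex_jacobian F z" for z
  proof (intro vec_tendstoI tendstoI)
    fix i j and e :: real assume e: "e > 0"
    then have "\<forall>\<^sub>F n in sequentially. \<forall>z\<in>cball 0 (norm z). \<forall>i j.
        norm (complex_jacobian (f n) z $ i $ j - complex_jacobian F z $ i $ j) \<le> e / 2"
      by (intro jac_ev) simp
    then show "\<forall>\<^sub>F n in sequentially. dist (complex_jacobian (f n) z $ i $ j) (complex_jacobian F z $ i $ j) < e"
    proof eventually_elim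
      case (elim n)
      then have "norm (complex_jacobian (f n) z $ i $ j - complex_jacobian F z $ i $ j) \<le> e / 2"
        by simp
      then show ?case using e by (simp add: dist_norm)
    qed
  qed
  have "(F has_derivative (\<lambda>h. complex_jacobian F z *v h)) (at z)" for z
  proof -
    define S where "S = ball (0 :: complex ^ 'k) (norm z + 1)"
    have "\<exists>g. \<forall>x\<in>S. (\<lambda>n. f n x) \<longlonglongrightarrow> g x \<and> (g has_derivative (\<lambda>h. complex_jacobian F x *v h)) (at x within S)"
    proof (rule has_derivative_sequence[of S f "\<lambda>n x h. complex_jacobian (f n) x *v h"])
      show "convex S" by (simp add: S_def)
      show "(f n has_derivative (\<lambda>h. complex_jacobian (f n) x *v h)) (at x within S)" for n x
        by (rule has_derivative_at_withinI[OF holomorphic_map_has_derivative[OF hol]])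
      fix e :: real assume "e > 0"
      define c where "c = real CARD('k)"
      have c: "c > 0" by (simp add: c_def)
      then have pos: "e / (c * c) > 0" using \<open>e > 0\<close> by simp
      show "\<forall>\<^sub>F n in sequentially. \<forall>x\<in>S. \<forall>h. norm (complex_jacobian (f n) x *v h - complex_jacobian F x *v h) \<le> e * norm h"
        using jac_ev[OF pos, of "norm z + 1"]
      proof eventually_elim
        case (elim n)
        show ?case
        proof (intro ballI allI)
          fix x h :: "complex ^ 'k" assume "x \<in> S"
          define B where "B = complex_jacobian (f n) x - complex_jacobian F x"
          have B: "norm (B $ i $ j) \<le> e / (c * c)" for i j
            using elim \<open>x \<in> S\<close> by (simp add: B_def S_def)
          have "norm (B *v h) \<le> CARD('k) * (c * (e / (c * c) * norm h))"
          proof (rule norm_le_card_times[of "B *v h"])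
            fix i
            have "norm ((B *v h) $ i) \<le> (\<Sum>j\<in>UNIV. norm (B $ i $ j) * norm (h $ j))"
              unfolding matrix_vector_mult_def vec_lambda_beta
              by (rule order.trans[OF norm_sum]) (simp add: norm_mult)
            also have "\<dots> \<le> (\<Sum>j\<in>(UNIV :: 'k set). e / (c * c) * norm h)"
              using B pos by (intro sum_mono mult_mono Finite_Cartesian_Product.norm_nth_le) auto
            finally show "norm ((B *v h) $ i) \<le> c * (e / (c * c) * norm h)"
              by (simp add: c_def)
          qed
          also have "\<dots> = e * norm h"
            using c by (simp flip: c_def)
          finally show "norm (complex_jacobian (f n) x *v h - complex_jacobian F x *v h) \<le> e * norm h"
            by (simp add: B_def matrix_vector_mult_diff_rdistrib)
        qed
      qed
    next
      show "z \<in> S" by (simp add: S_def)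
      show "(\<lambda>n. f n z) \<longlonglongrightarrow> F z"
        using tendsto_uniform_limitI[OF lim[of "norm z"]] by auto
    qed
    then obtain g where g: "\<And>x. x \<in> S \<Longrightarrow> (\<lambda>n. f n x) \<longlonglongrightarrow> g x"
       "\<And>x. x \<in> S \<Longrightarrow> (g has_derivative (\<lambda>h. complex_jacobian F x *v h)) (at x within S)"
      by blast
    have S: "open S" "z \<in> S" by (auto simp: S_def)
    have "g x = F x" if "x \<in> S" for x
      using LIMSEQ_unique[OF g(1)[OF that]] tendsto_uniform_limitI[OF lim[of "norm x"]] by auto
    moreover have "(g has_derivative (\<lambda>h. complex_jacobian F z *v h)) (at z)"
      using g(2)[OF S(2)] at_within_open[OF S(2,1)] by simp
    ultimately show ?thesis
      using has_derivative_transform_within_open[OF _ S] by blast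
  qed
  then show "holomorphic_map F" unfolding holomorphic_map_def by blast
qed

section \<open>Sweeping into the corners\<close>

definition re_strip :: "real \<Rightarrow> (complex ^ 'k) set" where
  "re_strip r = {z. \<forall>i. \<bar>Re (z $ i)\<bar> \<le> r}"

text \<open>The two far corners of \<open>\<complex>\<^sup>k\<close>. All the sets to be avoided are swept into them, because a corner can be
  pushed outwards by shears of which only the sign and size of the real part are known.\<close>

definition re_corners :: "real \<Rightarrow> (complex ^ 'k) set" where
  "re_corners R = {z. (\<forall>i. Re (z $ i) \<ge> R) \<or> (\<forall>i. Re (z $ i) \<le> - R)}"

lemma re_strip_mono: "r \<le> s \<Longrightarrow> re_strip r \<subseteq> re_strip s"
  by (auto simp: re_strip_def intro: order.trans)

lemma re_strip_move:
  assumes "z \<in> re_strip r" "norm (w - z) \<le> d"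
  shows "w \<in> re_strip (r + d)"
proof -
  have "\<bar>Re (w $ i)\<bar> \<le> r + d" for i
  proof -
    have "\<bar>Re (w $ i) - Re (z $ i)\<bar> \<le> d"
      using assms(2) Finite_Cartesian_Product.norm_nth_le[of "w - z" i] abs_Re_le_cmod[of "w $ i - z $ i"] by simp
    moreover have "\<bar>Re (z $ i)\<bar> \<le> r" using assms(1) by (simp add: re_strip_def)
    ultimately show ?thesis by linarith
  qed
  then show ?thesis by (simp add: re_strip_def)
qed

lemma cball_subset_re_strip: "cball 0 r \<subseteq> re_strip r"
proof
  fix z :: "complex ^ 'k" assume "z \<in> cball 0 r"
  then have "\<bar>Re (z $ i)\<bar> \<le> r" for i
    using Finite_Cartesian_Product.norm_nth_le[of z i] abs_Re_le_cmod[of "z $ i"] by simp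
  then show "z \<in> re_strip r" by (simp add: re_strip_def)
qed

lemma re_strip_disjoint_re_corners:
  assumes "r < R" "0 \<le> r"
  shows "re_strip r \<inter> re_corners R = {}"
proof -
  have "z \<notin> re_corners R" if "z \<in> re_strip r" for z :: "complex ^ 'k"
  proof
    assume "z \<in> re_corners R"
    then have "\<bar>Re (z $ undefined)\<bar> \<ge> R"
      using assms unfolding re_corners_def by (auto dest!: spec[of _ undefined])
    then show False
      using that assms unfolding re_strip_def by (auto dest!: spec[of _ undefined])
  qed
  then show ?thesis by auto
qed

text \<open>It is the inverse of this map that pushes: first by \<open>f\<close> of coordinate \<open>p\<close> in all other coordinates,
  then by \<open>g\<close> of the new coordinate \<open>q\<close> in coordinate \<open>p\<close>. The map itself is the factor by which the final
  map will be composed.\<close>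

definition double_shear ::
  "'k \<Rightarrow> 'k \<Rightarrow> (complex \<Rightarrow> complex) \<Rightarrow> (complex \<Rightarrow> complex) \<Rightarrow> complex ^ 'k \<Rightarrow> complex ^ 'k" where
  "double_shear p q f g = shear p (\<chi> i. if i = p then 0 else 1) (\<lambda>x. - f x) \<circ> shear q (axis p 1) (\<lambda>x. - g x)"

lemma double_shear:
  assumes "p \<noteq> q" "f holomorphic_on UNIV" "g holomorphic_on UNIV"
  shows "vp_automorphism (double_shear p q f g)"
    and "i \<noteq> p \<Longrightarrow> inv (double_shear p q f g) z $ i = z $ i + f (z $ p)"
    and "inv (double_shear p q f g) z $ p = z $ p + g (z $ q + f (z $ p))"
    and "i \<noteq> p \<Longrightarrow> double_shear p q f g z $ i = z $ i - f (z $ p - g (z $ q))"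
    and "double_shear p q f g z $ p = z $ p - g (z $ q)"
proof -
  define v :: "complex ^ 'a" where "v = (\<chi> i. if i = p then 0 else 1)"
  define w :: "complex ^ 'a" where "w = axis p 1"
  have v: "v $ p = 0" and w: "w $ q = 0" using assms by (auto simp: v_def w_def axis_def)
  have eq: "double_shear p q f g = shear p v (\<lambda>x. - f x) \<circ> shear q w (\<lambda>x. - g x)"
    by (simp add: double_shear_def v_def w_def)
  show "vp_automorphism (double_shear p q f g)"
    unfolding eq using assms v w by (intro vp_automorphism_comp shear_automorphism holomorphic_intros)
  have "inv (double_shear p q f g) = inv (shear q w (\<lambda>x. - g x)) \<circ> inv (shear p v (\<lambda>x. - f x))"
    unfolding eq using inv_shear[OF v] inv_shear[OF w] by (intro o_inv_distrib)
  then have inv_eq: "inv (double_shear p q f g) = shear q w g \<circ> shear p v f"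
    by (simp add: inv_shear(2)[OF v] inv_shear(2)[OF w])
  show "i \<noteq> p \<Longrightarrow> inv (double_shear p q f g) z $ i = z $ i + f (z $ p)"
    "inv (double_shear p q f g) z $ p = z $ p + g (z $ q + f (z $ p))"
    unfolding inv_eq using assms by (auto simp: shear_def v_def w_def axis_def)
  show "i \<noteq> p \<Longrightarrow> double_shear p q f g z $ i = z $ i - f (z $ p - g (z $ q))"
    "double_shear p q f g z $ p = z $ p - g (z $ q)"
    unfolding eq using assms by (auto simp: shear_def v_def w_def axis_def)
qed

lemma two_coordinates:
  assumes "CARD('k::finite) \<ge> 2"
  obtains p q :: "'k::finite" where "p \<noteq> q"
proof -
  have "\<not> card (UNIV :: 'k set) \<le> Suc 0" using assms by simp
  then have "\<exists>p q :: 'k. p \<noteq> q" by (subst (asm) card_le_Suc0_iff_eq) auto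
  then show ?thesis using that by blast
qed

text \<open>Take a barrier for both shears. In a corner coordinate \<open>p\<close> drives all the other coordinates outwards
  in the same direction; coordinate \<open>q\<close>, still in the same half plane, then drives coordinate \<open>p\<close>.\<close>

lemma push_automorphism:
  fixes r \<epsilon> M :: real
  assumes "CARD('k::finite) \<ge> 2" and "r \<ge> 0" "0 < \<epsilon>" "\<epsilon> \<le> 1" "M > 0"
  shows "\<exists>H :: complex ^ 'k \<Rightarrow> complex ^ 'k. vp_automorphism H \<and>
    (\<forall>z\<in>re_strip r. norm (H z - z) \<le> \<epsilon>) \<and> (\<forall>z\<in>re_strip r. norm (inv H z - z) \<le> \<epsilon>) \<and>
    inv H ` re_corners (r + 2) \<subseteq> re_corners M"
proof -
  obtain p q :: 'k where pq: "p \<noteq> q" using two_coordinates[OF assms(1)] .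
  define c where "c = real CARD('k)"
  have c: "c \<ge> 1" using assms(1) by (simp add: c_def)
  \<comment> \<open>Each coordinate may move by \<open>\<epsilon> / c\<close>; as this is at most \<open>1\<close>, the second shear still acts within
    the strip \<open>r + 1\<close>, where the barrier is small.\<close>
  have small: "\<epsilon> / c > 0" "\<epsilon> / c \<le> 1"
    using c assms by (auto simp: divide_le_eq)
  obtain g where g: "g holomorphic_on UNIV"
    and g_in: "\<And>z. \<bar>Re z\<bar> \<le> r + 1 \<Longrightarrow> norm (g z) \<le> \<epsilon> / c"
    and g_right: "\<And>z. Re z \<ge> r + 1 + 1 \<Longrightarrow> Re (g z) \<ge> M"
    and g_left: "\<And>z. Re z \<le> - (r + 1 + 1) \<Longrightarrow> Re (g z) \<le> - M"
    using entire_barrier[of "r + 1" "\<epsilon> / c" M] assms small by auto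
  define H where "H = double_shear p q g g"
  note H = double_shear[OF pq g g, folded H_def]
  have total: "norm w \<le> \<epsilon>" if "\<And>i. norm (w $ i) \<le> \<epsilon> / c" for w :: "complex ^ 'k"
    using norm_le_card_times[OF that] c by (simp flip: c_def)
  have shift: "\<bar>Re (x + g y)\<bar> \<le> r + 1" "\<bar>Re (x - g y)\<bar> \<le> r + 1" if "\<bar>Re x\<bar> \<le> r" "\<bar>Re y\<bar> \<le> r" for x y
    using that g_in[of y] abs_Re_le_cmod[of "g y"] small by auto
  have "norm (H z - z) \<le> \<epsilon>" "norm (inv H z - z) \<le> \<epsilon>" if z: "z \<in> re_strip r" for z
  proof -
    have re: "\<bar>Re (z $ i)\<bar> \<le> r" for i using z by (simp add: re_strip_def)
    then have re1: "\<bar>Re (z $ i)\<bar> \<le> r + 1" for i by (meson add_increasing2 order.trans zero_le_one)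
    show "norm (H z - z) \<le> \<epsilon>"
    proof (rule total)
      fix i show "norm ((H z - z) $ i) \<le> \<epsilon> / c"
        using g_in[OF re1] g_in[OF shift(2)[OF re re]] by (cases "i = p") (auto simp: H)
    qed
    show "norm (inv H z - z) \<le> \<epsilon>"
    proof (rule total)
      fix i show "norm ((inv H z - z) $ i) \<le> \<epsilon> / c"
        using g_in[OF re1] g_in[OF shift(1)[OF re re]] by (cases "i = p") (auto simp: H)
    qed
  qed
  moreover have "inv H z \<in> re_corners M" if z: "z \<in> re_corners (r + 2)" for z
    using z unfolding re_corners_def
  proof (elim CollectE disjE)
    assume re: "\<forall>i. Re (z $ i) \<ge> r + 2"
    have 1: "Re (g (z $ p)) \<ge> M" using re[rule_format, of p] g_right[of "z $ p"] by simp
    have 2: "Re (g (z $ q + g (z $ p))) \<ge> M"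
      using re[rule_format, of q] 1 assms by (intro g_right) simp
    have "Re (inv H z $ i) \<ge> M" for i
      using re[rule_format, of i] 1 2 assms by (cases "i = p") (auto simp: H)
    then show "inv H z \<in> {z. (\<forall>i. Re (z $ i) \<ge> M) \<or> (\<forall>i. Re (z $ i) \<le> - M)}" by simp
  next
    assume re: "\<forall>i. Re (z $ i) \<le> - (r + 2)"
    have 1: "Re (g (z $ p)) \<le> - M" using re[rule_format, of p] g_left[of "z $ p"] by simp
    have 2: "Re (g (z $ q + g (z $ p))) \<le> - M"
      using re[rule_format, of q] 1 assms by (intro g_left) simp
    have "Re (inv H z $ i) \<le> - M" for i
      using re[rule_format, of i] 1 2 assms by (cases "i = p") (auto simp: H)
    then show "inv H z \<in> {z. (\<forall>i. Re (z $ i) \<ge> M) \<or> (\<forall>i. Re (z $ i) \<le> - M)}" by simp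
  qed
  ultimately show ?thesis
    using H(1) by (intro exI[of _ H]) auto
qed

definition avoided :: "real \<Rightarrow> int \<Rightarrow> (complex ^ 'k) set" where
  "avoided a K =
    (\<Union>l\<in>{l. \<forall>i. 1 \<le> l i \<and> l i \<le> K + 1}.
       cart_prod (\<lambda>i. V_set a K (l i)) \<union> cart_prod (\<lambda>i. V_set a K (- l i))) \<union>
    (\<Union>l\<in>{l. \<forall>i. 1 \<le> \<bar>l i\<bar> \<and> \<bar>l i\<bar> \<le> K + 1}. cart_prod (\<lambda>i. D_set a (l i)))"

definition covered :: "real \<Rightarrow> int \<Rightarrow> (complex ^ 'k) set" where
  "covered a K = (\<Union>l\<in>{l. \<forall>i. 1 \<le> \<bar>l i\<bar> \<and> \<bar>l i\<bar> \<le> K + 1}. cart_prod (\<lambda>i. E_set a (l i)))"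

text \<open>The first shear uses the separator. At a point to be avoided coordinate \<open>p\<close> lies in some \<open>V\<close> or \<open>D\<close>, and
  the other coordinates, which lie on the same side or have bounded real part, are thrown to the side of
  coordinate \<open>p\<close>; a barrier in coordinate \<open>q\<close> then takes coordinate \<open>p\<close> along. Points of products of
  sets \<open>E\<close> change their real parts by at most \<open>1\<close>. Mixed signs in the products of discs \<open>D\<close> do no harm, since
  the side of coordinate \<open>p\<close> alone decides.\<close>

lemma separating_automorphism:
  assumes "CARD('k::finite) \<ge> 2" and "a > 0" "K \<ge> 1"
  shows "\<exists>(F :: complex ^ 'k \<Rightarrow> complex ^ 'k) r. vp_automorphism F \<and> r \<ge> 0 \<and>
    inv F ` avoided a K \<subseteq> re_corners (r + 2) \<and> inv F ` covered a K \<subseteq> re_strip r"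
proof -
  obtain p q :: 'k where pq: "p \<noteq> q" using two_coordinates[OF assms(1)] .
  \<comment> \<open>All discs lie in \<open>\<bar>Re z\<bar> \<le> r - 1\<close>, and a push by \<open>2 r + 2\<close> takes anything above \<open>- r\<close> beyond \<open>r + 2\<close>.\<close>
  define r where "r = a + 2 * real_of_int K + 2"
  have r: "r > 0" using assms by (simp add: r_def)
  obtain f where f: "f holomorphic_on UNIV"
    and f_avoid: "\<And>l z. 1 \<le> \<bar>l\<bar> \<Longrightarrow> \<bar>l\<bar> \<le> K + 1 \<Longrightarrow> z \<in> V_set a K l \<union> D_set a l \<Longrightarrow> of_int (sgn l) * Re (f z) \<ge> 2 * r + 2"
    and f_keep: "\<And>l z. 1 \<le> \<bar>l\<bar> \<Longrightarrow> \<bar>l\<bar> \<le> K + 1 \<Longrightarrow> z \<in> E_set a l \<Longrightarrow> \<bar>Re (f z)\<bar> \<le> 1"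
    using entire_separator[of a K "2 * r + 2"] assms r by auto
  obtain g where g: "g holomorphic_on UNIV"
    and g_in: "\<And>z. \<bar>Re z\<bar> \<le> r \<Longrightarrow> norm (g z) \<le> 1"
    and g_right: "\<And>z. Re z \<ge> r + 1 \<Longrightarrow> Re (g z) \<ge> 2 * r + 2"
    and g_left: "\<And>z. Re z \<le> - (r + 1) \<Longrightarrow> Re (g z) \<le> - (2 * r + 2)"
    using entire_barrier[of r 1 "2 * r + 2"] r by auto
  define F where "F = double_shear p q f g"
  note F = double_shear[OF pq f g, folded F_def]
  have right: "inv F z \<in> re_corners (r + 2)"
    if "Re (f (z $ p)) \<ge> 2 * r + 2" "\<And>i. Re (z $ i) \<ge> - r" for z
  proof -
    have "Re (g (z $ q + f (z $ p))) \<ge> 2 * r + 2"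
      using that(1) that(2)[of q] by (intro g_right) simp
    then have "Re (inv F z $ i) \<ge> r + 2" for i
      using that(1) that(2)[of i] by (cases "i = p") (auto simp: F)
    then show ?thesis by (simp add: re_corners_def)
  qed
  have left: "inv F z \<in> re_corners (r + 2)"
    if "Re (f (z $ p)) \<le> - (2 * r + 2)" "\<And>i. Re (z $ i) \<le> r" for z
  proof -
    have "Re (g (z $ q + f (z $ p))) \<le> - (2 * r + 2)"
      using that(1) that(2)[of q] by (intro g_left) simp
    then have "Re (inv F z $ i) \<le> - (r + 2)" for i
      using that(1) that(2)[of i] by (cases "i = p") (auto simp: F)
    then show ?thesis by (simp add: re_corners_def)
  qed
  have near: "\<bar>Re x\<bar> \<le> r - 1" if "x \<in> D_set a l \<union> E_set a l" "1 \<le> \<bar>l\<bar>" "\<bar>l\<bar> \<le> K + 1" for x l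
    using Re_near_c_centre[OF that(1)] abs_c_centre_le[OF assms(2) that(2,3)] unfolding r_def by linarith
  have "inv F z \<in> re_corners (r + 2)" if "z \<in> avoided a K" for z
  proof -
    from that have
      "(\<exists>l. (\<forall>i. 1 \<le> l i \<and> l i \<le> K + 1) \<and> (\<forall>i. z $ i \<in> V_set a K (l i))) \<or>
       (\<exists>l. (\<forall>i. 1 \<le> l i \<and> l i \<le> K + 1) \<and> (\<forall>i. z $ i \<in> V_set a K (- l i))) \<or>
       (\<exists>l. (\<forall>i. 1 \<le> \<bar>l i\<bar> \<and> \<bar>l i\<bar> \<le> K + 1) \<and> (\<forall>i. z $ i \<in> D_set a (l i)))"
      unfolding avoided_def cart_prod_def by (simp only: Un_iff UN_iff mem_Collect_eq bex_simps) blast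
    then consider
      l where "\<And>i. 1 \<le> l i" "\<And>i. l i \<le> K + 1" "\<And>i. z $ i \<in> V_set a K (l i)"
    | l where "\<And>i. 1 \<le> l i" "\<And>i. l i \<le> K + 1" "\<And>i. z $ i \<in> V_set a K (- l i)"
    | l where "\<And>i. 1 \<le> \<bar>l i\<bar>" "\<And>i. \<bar>l i\<bar> \<le> K + 1" "\<And>i. z $ i \<in> D_set a (l i)"
      by (elim disjE exE conjE) blast+
    then show ?thesis
    proof cases
      case 1
      have l: "1 \<le> \<bar>l i\<bar>" "\<bar>l i\<bar> \<le> K + 1" "sgn (l i) = 1" for i
        using 1(1,2)[of i] by auto
      show ?thesis
      proof (rule right)
        show "Re (f (z $ p)) \<ge> 2 * r + 2"
          using f_avoid[OF l(1,2), of "z $ p" p] 1(3) l(3) by simp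
        show "Re (z $ i) \<ge> - r" for i
          using V_set_side[OF assms(2) l(1,2) 1(3)[of i]] l(3)[of i] r assms(2) by simp
      qed
    next
      case 2
      have l: "1 \<le> \<bar>- l i\<bar>" "\<bar>- l i\<bar> \<le> K + 1" "sgn (- l i) = - 1" for i
        using 2(1,2)[of i] by auto
      show ?thesis
      proof (rule left)
        show "Re (f (z $ p)) \<le> - (2 * r + 2)"
          using f_avoid[OF l(1,2), of "z $ p" p] 2(3) l(3)[of p] by simp
        show "Re (z $ i) \<le> r" for i
          using V_set_side[OF assms(2) l(1,2) 2(3)[of i]] l(3)[of i] r assms(2) by simp
      qed
    next
      case 3
      have re: "\<bar>Re (z $ i)\<bar> \<le> r - 1" for i
        using near 3 by blast
      have re': "Re (z $ i) \<ge> - r" "Re (z $ i) \<le> r" for i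
        using re[of i] by linarith+
      have f_p: "of_int (sgn (l p)) * Re (f (z $ p)) \<ge> 2 * r + 2"
        using f_avoid[OF 3(1,2), of "z $ p" p] 3(3) by blast
      show ?thesis
      proof (cases "l p > 0")
        case True
        then show ?thesis using f_p re' by (intro right) auto
      next
        case False
        then have "sgn (l p) = - 1" using 3(1)[of p] by auto
        then show ?thesis using f_p re' by (intro left) auto
      qed
    qed
  qed
  moreover have "inv F z \<in> re_strip r" if "z \<in> covered a K" for z
  proof -
    from that have "\<exists>l. (\<forall>i. 1 \<le> \<bar>l i\<bar> \<and> \<bar>l i\<bar> \<le> K + 1) \<and> (\<forall>i. z $ i \<in> E_set a (l i))"
      unfolding covered_def cart_prod_def by (simp only: UN_iff mem_Collect_eq) blast
    then obtain l where l: "\<And>i. 1 \<le> \<bar>l i\<bar>" "\<And>i. \<bar>l i\<bar> \<le> K + 1" "\<And>i. z $ i \<in> E_set a (l i)"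
      by (elim exE conjE) blast
    have re: "\<bar>Re (z $ i)\<bar> \<le> r - 1" for i
      using near l by blast
    have 1: "\<bar>Re (f (z $ p))\<bar> \<le> 1"
      using f_keep[OF l] .
    have "\<bar>Re (z $ q + f (z $ p))\<bar> \<le> r"
      using re[of q] 1 by simp
    then have "\<bar>Re (g (z $ q + f (z $ p)))\<bar> \<le> 1"
      using g_in abs_Re_le_cmod order.trans by blast
    then have "\<bar>Re (inv F z $ i)\<bar> \<le> r" for i
      using re[of i] 1 by (cases "i = p") (auto simp: F)
    then show ?thesis by (simp add: re_strip_def)
  qed
  ultimately show ?thesis
    using F(1) r by (intro exI[of _ F] exI[of _ r]) auto
qed

section \<open>The limit of the corrected maps\<close>

lemma vp_automorphism_inv [simp]:
  assumes "vp_automorphism F"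
  shows "F (inv F z) = z" "inv F (F z) = z"
  using assms by (auto simp: vp_automorphism_def bij_is_surj surj_f_inv_f bij_is_inj)

text \<open>A pushing automorphism close enough to the identity, where the meaning of close depends on the map
  \<open>F\<close> built so far: uniform continuity of \<open>F\<close> on a ball bounds the change from \<open>F\<close> to \<open>F \<circ> H\<close>.\<close>

lemma correction_exists:
  fixes F :: "complex ^ 'k::finite \<Rightarrow> complex ^ 'k"
  assumes "CARD('k) \<ge> 2" "r \<ge> 0" "vp_automorphism F"
  shows "\<exists>H. vp_automorphism H \<and>
    (\<forall>z\<in>re_strip (r + real n). norm (H z - z) \<le> (1/2) ^ Suc n \<and> norm (inv H z - z) \<le> (1/2) ^ Suc n) \<and>
    inv H ` re_corners (r + real n + 2) \<subseteq> re_corners (r + real (Suc n) + 2) \<and>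
    (\<forall>z\<in>cball 0 (real n). norm (F (H z) - F z) \<le> (1/2) ^ n)"
proof -
  have "uniformly_continuous_on (cball 0 (real n + 1)) F"
    using assms(3) by (intro compact_uniformly_continuous holomorphic_map_continuous) (auto simp: vp_automorphism_def)
  moreover have "(1/2::real) ^ n > 0" by simp
  ultimately obtain \<delta> where \<delta>: "\<delta> > 0"
    "\<And>z w. z \<in> cball 0 (real n + 1) \<Longrightarrow> w \<in> cball 0 (real n + 1) \<Longrightarrow> dist w z < \<delta> \<Longrightarrow> dist (F w) (F z) < (1/2) ^ n"
    unfolding uniformly_continuous_on_def by blast
  define \<epsilon> where "\<epsilon> = min (\<delta> / 2) ((1/2) ^ Suc n)"
  have "(1/2::real) ^ Suc n \<le> 1" by (intro power_le_one) auto
  then have \<epsilon>: "0 < \<epsilon>" "\<epsilon> \<le> 1" "\<epsilon> < \<delta>" "\<epsilon> \<le> (1/2) ^ Suc n"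
    using \<delta>(1) by (auto simp: \<epsilon>_def)
  obtain H :: "complex ^ 'k \<Rightarrow> complex ^ 'k" where H: "vp_automorphism H"
    "\<And>z. z \<in> re_strip (r + real n) \<Longrightarrow> norm (H z - z) \<le> \<epsilon>"
    "\<And>z. z \<in> re_strip (r + real n) \<Longrightarrow> norm (inv H z - z) \<le> \<epsilon>"
    "inv H ` re_corners (r + real n + 2) \<subseteq> re_corners (r + real (Suc n) + 2)"
    using push_automorphism[OF assms(1), of "r + real n" \<epsilon> "r + real (Suc n) + 2"] assms(2) \<epsilon> by auto
  have "norm (F (H z) - F z) \<le> (1/2) ^ n" if z: "z \<in> cball 0 (real n)" for z
  proof -
    have "z \<in> cball 0 (r + real n)" using z assms(2) by simp
    then have "z \<in> re_strip (r + real n)" by (rule subsetD[OF cball_subset_re_strip])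
    then have near: "norm (H z - z) \<le> \<epsilon>" by (rule H(2))
    then have "norm (H z) \<le> real n + 1"
      using norm_triangle_ineq[of "H z - z" z] z \<epsilon>(2) by simp
    then show ?thesis
      using \<delta>(2)[of z "H z"] near \<epsilon>(3) z by (simp add: dist_norm)
  qed
  then show ?thesis
    using H(1,4) order.trans[OF H(2) \<epsilon>(4)] order.trans[OF H(3) \<epsilon>(4)] by blast
qed

text \<open>Most claims on the limit \<open>G\<close> of \<open>F n = F 0 \<circ> H 0 \<circ> \<dots> \<circ> H (n - 1)\<close> rest on one estimate: on a strip that
  grows with \<open>m\<close>, the map \<open>inv (F m) \<circ> G\<close> is within \<open>(1/2)\<^sup>m\<close> of the identity. It makes \<open>G\<close> injective,
  since \<open>G z = G w\<close> forces \<open>\<bar>z - w\<bar> \<le> 2 (1/2)\<^sup>m\<close> for all large \<open>m\<close>. It keeps \<open>G z\<close> off the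
  avoided set: \<open>inv (F m)\<close> sends \<open>G z\<close> near \<open>z\<close>, hence into the strip, but avoided points into the corners
  beyond it. A point \<open>x\<close> to be covered has preimages \<open>inv (F n) x\<close> that move by a summable amount, and \<open>G\<close>
  takes their limit to \<open>x\<close>.\<close>

lemma limit_of_corrections:
  fixes F H :: "nat \<Rightarrow> complex ^ 'k::finite \<Rightarrow> complex ^ 'k"
  assumes r: "r \<ge> 0"
    and F: "\<And>n. vp_automorphism (F n)" and H: "\<And>n. vp_automorphism (H n)"
    and F_Suc: "\<And>n. F (Suc n) = F n \<circ> H n"
    and near: "\<And>n z. z \<in> re_strip (r + real n) \<Longrightarrow> norm (H n z - z) \<le> (1/2) ^ Suc n"
    and near_inv: "\<And>n z. z \<in> re_strip (r + real n) \<Longrightarrow> norm (inv (H n) z - z) \<le> (1/2) ^ Suc n"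
    and push: "\<And>n. inv (H n) ` re_corners (r + real n + 2) \<subseteq> re_corners (r + real (Suc n) + 2)"
    and close: "\<And>n z. norm z \<le> real n \<Longrightarrow> norm (F n (H n z) - F n z) \<le> (1/2) ^ n"
  defines "G \<equiv> \<lambda>z. lim (\<lambda>n. F n z)"
  shows "inj G" "holomorphic_map G" "volume_preserving G"
    and "inv (F 0) x \<in> re_corners (r + 2) \<Longrightarrow> x \<notin> range G"
    and "inv (F 0) x \<in> re_strip r \<Longrightarrow> x \<in> range G"
proof -
  have ulim: "uniform_limit (cball 0 R) F G sequentially" for R
    unfolding G_def
  proof (rule geometric_uniform_limit)
    fix n and z :: "complex ^ 'k" assume "nat \<lceil>R\<rceil> \<le> n" "z \<in> cball 0 R"
    then have "norm z \<le> real n" by (simp add: nat_le_iff ceiling_le_iff)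
    then show "norm (F (Suc n) z - F n z) \<le> 1 * (1/2) ^ n"
      using close by (simp add: F_Suc)
  qed
  have lim: "(\<lambda>n. F n z) \<longlonglongrightarrow> G z" for z
    using tendsto_uniform_limitI[OF ulim[of "norm z"]] by simp
  have hol: "holomorphic_map (F n)" "volume_preserving (F n)" "holomorphic_map (inv (F n))" for n
    using F by (auto simp: vp_automorphism_def)
  show "holomorphic_map G"
    by (rule holomorphic_map_limit(1)[OF hol(1) ulim])
  have "(\<lambda>n. det (complex_jacobian (F n) z)) \<longlonglongrightarrow> det (complex_jacobian G z)" for z
    unfolding det_def
    by (intro tendsto_intros tendsto_sum tendsto_prod tendsto_vec_nth holomorphic_map_limit(2)[OF hol(1) ulim])
  then have "det (complex_jacobian G z) = 1" for z
    using hol(2) LIMSEQ_unique[OF _ tendsto_const] unfolding volume_preserving_def by force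
  then show "volume_preserving G" by (simp add: volume_preserving_def)

  have inv_Suc: "inv (F (Suc n)) x = inv (H n) (inv (F n) x)" for n x
  proof -
    have "inv (F (Suc n)) = inv (H n) \<circ> inv (F n)"
      unfolding F_Suc using F H by (intro o_inv_distrib) (auto simp: vp_automorphism_def)
    then show ?thesis by simp
  qed

  \<comment> \<open>The total movement by \<open>H m, \<dots>, H (m + k - 1)\<close> is at most the geometric sum
    \<open>(1/2) ^ m - (1/2) ^ (m + k)\<close>, by which the strip is shrunk to leave room for it.\<close>
  have tail: "norm (inv (F m) (F (m + k) z) - z) \<le> (1/2) ^ m - (1/2) ^ (m + k)"
    if "z \<in> re_strip (r + real m - ((1/2) ^ m - (1/2) ^ (m + k)))" for m k z
    using that
  proof (induction k arbitrary: z)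
    case 0
    then show ?case using F by simp
  next
    case (Suc k)
    let ?d = "\<lambda>k. (1/2::real) ^ m - (1/2) ^ (m + k)"
    have d: "?d (Suc k) = ?d k + (1/2) ^ Suc (m + k)" by simp
    have "?d (Suc k) \<ge> 0" using power_decreasing[of m "m + Suc k" "1/2::real"] by simp
    then have "z \<in> re_strip (r + real (m + k))"
      using Suc.prems re_strip_mono[of "r + real m - ?d (Suc k)" "r + real (m + k)"] by auto
    then have n: "norm (H (m + k) z - z) \<le> (1/2) ^ Suc (m + k)" by (rule near)
    have "r + real m - ?d (Suc k) + (1/2) ^ Suc (m + k) = r + real m - ?d k"
      using d by linarith
    with re_strip_move[OF Suc.prems n] have "H (m + k) z \<in> re_strip (r + real m - ?d k)"
      by (simp only:)
    from Suc.IH[OF this] have "norm (inv (F m) (F (m + k) (H (m + k) z)) - H (m + k) z) \<le> ?d k" .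
    then have "norm (inv (F m) (F (m + k) (H (m + k) z)) - z) \<le> ?d k + (1/2) ^ Suc (m + k)"
      using n norm_triangle_le[of "inv (F m) (F (m + k) (H (m + k) z)) - H (m + k) z" "H (m + k) z - z"] by simp
    then show ?case by (simp add: F_Suc)
  qed
  have near_id: "norm (inv (F m) (G z) - z) \<le> (1/2) ^ m" if z: "z \<in> re_strip (r + real m - 1)" for m z
  proof -
    have cont: "isCont (inv (F m)) (G z)"
      using holomorphic_map_continuous[OF hol(3), of UNIV] continuous_on_eq_continuous_at by blast
    have "(\<lambda>k. F (k + m) z) \<longlonglongrightarrow> G z"
      by (rule LIMSEQ_ignore_initial_segment[OF lim])
    then have "(\<lambda>k. norm (inv (F m) (F (k + m) z) - z)) \<longlonglongrightarrow> norm (inv (F m) (G z) - z)"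
      by (intro tendsto_intros isCont_tendsto_compose[OF cont])
    moreover have "norm (inv (F m) (F (k + m) z) - z) \<le> (1/2) ^ m" for k
    proof -
      have "(1/2::real) ^ m \<le> 1" "(0::real) \<le> (1/2) ^ (m + k)" by (auto intro: power_le_one)
      then have "re_strip (r + real m - 1) \<subseteq> (re_strip (r + real m - ((1/2) ^ m - (1/2) ^ (m + k))) :: (complex ^ 'k) set)"
        by (intro re_strip_mono) linarith
      with z have "norm (inv (F m) (F (m + k) z) - z) \<le> (1/2) ^ m - (1/2) ^ (m + k)"
        by (intro tail) blast
      also have "\<dots> \<le> (1/2) ^ m" using \<open>(0::real) \<le> (1/2) ^ (m + k)\<close> by linarith
      finally show ?thesis by (simp only: add.commute)
    qed
    ultimately show ?thesis
      by (intro LIMSEQ_le_const2) auto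
  qed
  have exhaust: "\<exists>M. \<forall>m\<ge>M. z \<in> re_strip (r + real m - 1)" for z :: "complex ^ 'k"
  proof -
    obtain M where M: "norm z + 1 \<le> real M" using real_arch_simple by blast
    have "z \<in> re_strip (r + real m - 1)" if "m \<ge> M" for m
    proof -
      have "norm z \<le> r + real m - 1" using M that r by linarith
      then have "z \<in> cball 0 (r + real m - 1)" by simp
      then show ?thesis by (rule subsetD[OF cball_subset_re_strip])
    qed
    then show ?thesis by blast
  qed

  show "inj G"
  proof (rule injI)
    fix z w assume eq: "G z = G w"
    obtain M where M: "\<forall>m\<ge>M. z \<in> re_strip (r + real m - 1)" using exhaust by blast
    obtain M' where M': "\<forall>m\<ge>M'. w \<in> re_strip (r + real m - 1)" using exhaust by blast
    have le: "norm (z - w) \<le> 2 * (1/2) ^ m" if "m \<ge> max M M'" for m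
      using near_id[of z m] near_id[of w m] M M' that eq
        norm_triangle_le_diff[of "inv (F m) (G z) - w" "inv (F m) (G z) - z"] by simp
    have "(\<lambda>m. 2 * (1/2::real) ^ m) \<longlonglongrightarrow> 2 * 0"
      by (intro tendsto_intros) auto
    from LIMSEQ_le_const[OF this] have "norm (z - w) \<le> 2 * 0"
      using le by blast
    then show "z = w" by simp
  qed

  show "x \<notin> range G" if x: "inv (F 0) x \<in> re_corners (r + 2)"
  proof
    assume "x \<in> range G"
    then obtain z where z: "x = G z" by blast
    have corners: "inv (F m) x \<in> re_corners (r + real m + 2)" for m
    proof (induction m)
      case (Suc m)
      then show ?case using push[of m] by (auto simp: inv_Suc)
    qed (use x in simp)
    obtain m where m: "z \<in> re_strip (r + real m - 1)" using exhaust by blast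
    have "norm (inv (F m) x - z) \<le> 1"
      using near_id[OF m] power_le_one[of "1/2::real" m] unfolding z by linarith
    from re_strip_move[OF m this] have "inv (F m) x \<in> re_strip (r + real m)" by simp
    with corners[of m] show False
      using re_strip_disjoint_re_corners[of "r + real m" "r + real m + 2"] r by auto
  qed

  show "x \<in> range G" if x: "inv (F 0) x \<in> re_strip r"
  proof -
    define p where "p n = inv (F n) x" for n
    have p_strip: "p n \<in> re_strip (r + real n)" for n
    proof (induction n)
      case (Suc n)
      have "norm (p (Suc n) - p n) \<le> (1/2) ^ Suc n"
        using near_inv[OF Suc] by (simp add: p_def inv_Suc)
      also have "\<dots> \<le> 1" by (intro power_le_one) auto
      finally show ?case using re_strip_move[OF Suc] by (simp add: add_ac)
    qed (use x in \<open>simp add: p_def\<close>)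
    have "norm (p (Suc n) - p n) \<le> (1/2) * (1/2) ^ n" for n
      using near_inv[OF p_strip[of n]] by (simp add: p_def inv_Suc)
    then have p_lim: "p \<longlonglongrightarrow> lim p"
      by (rule geometric_limit(1)[of 0])
    have "\<forall>\<^sub>F n in sequentially. norm (p n) < norm (lim p) + 1"
      using tendsto_norm[OF p_lim] by (rule order_tendstoD) simp
    then have bounded: "\<forall>\<^sub>F n in sequentially. p n \<in> cball 0 (norm (lim p) + 1)"
      by eventually_elim simp
    have "(\<lambda>n. G (p n)) \<longlonglongrightarrow> G (lim p)"
      using holomorphic_map_continuous[OF \<open>holomorphic_map G\<close>, of UNIV] p_lim
      by (auto intro: isCont_tendsto_compose simp: continuous_on_eq_continuous_at)
    have "(\<lambda>n. F n (p n)) \<longlonglongrightarrow> G (lim p)"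
    proof (rule tendstoI)
      fix e :: real assume "e > 0"
      then have "\<forall>\<^sub>F n in sequentially. \<forall>y\<in>cball 0 (norm (lim p) + 1). dist (F n y) (G y) < e / 2"
        by (intro uniform_limitD[OF ulim]) simp
      moreover have "\<forall>\<^sub>F n in sequentially. dist (G (p n)) (G (lim p)) < e / 2"
        using \<open>(\<lambda>n. G (p n)) \<longlonglongrightarrow> G (lim p)\<close> \<open>e > 0\<close> by (intro tendstoD) auto
      ultimately show "\<forall>\<^sub>F n in sequentially. dist (F n (p n)) (G (lim p)) < e"
        using bounded
      proof eventually_elim
        case (elim n)
        then show ?case
          using dist_triangle_half_r[of "G (p n)" "F n (p n)" e "G (lim p)"] by (simp add: dist_commute)
      qed
    qed
    moreover have "F n (p n) = x" for n
      using F by (simp add: p_def)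
    ultimately have "x = G (lim p)" by (simp add: LIMSEQ_const_iff)
    then show ?thesis by blast
  qed
qed

lemma map_avoiding_and_covering:
  fixes a :: real and K :: int
  assumes "CARD('k::finite) \<ge> 2" and "a > 0" and "K \<ge> 1"
  shows "\<exists>G :: complex ^ 'k \<Rightarrow> complex ^ 'k. inj G \<and> holomorphic_map G \<and> volume_preserving G \<and>
    avoided a K \<inter> range G = {} \<and> covered a K \<subseteq> range G"
proof -
  obtain F0 :: "complex ^ 'k \<Rightarrow> complex ^ 'k" and r where F0: "vp_automorphism F0" "r \<ge> 0"
    "inv F0 ` avoided a K \<subseteq> re_corners (r + 2)" "inv F0 ` covered a K \<subseteq> re_strip r"
    using separating_automorphism[OF assms] by blast
  define good where "good n F H \<longleftrightarrow> vp_automorphism H \<and>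
    (\<forall>z\<in>re_strip (r + real n). norm (H z - z) \<le> (1/2) ^ Suc n \<and> norm (inv H z - z) \<le> (1/2) ^ Suc n) \<and>
    inv H ` re_corners (r + real n + 2) \<subseteq> re_corners (r + real (Suc n) + 2) \<and>
    (\<forall>z\<in>cball 0 (real n). norm (F (H z) - F z) \<le> (1/2) ^ n)"
    for n and F H :: "complex ^ 'k \<Rightarrow> complex ^ 'k"
  define next_map where "next_map n F = (SOME H. good n F H)" for n F
  have next_map: "good n F (next_map n F)" if "vp_automorphism F" for n F
    unfolding next_map_def good_def
    by (rule someI_ex[OF correction_exists[OF assms(1) F0(2) that]])
  define F where "F = rec_nat F0 (\<lambda>n F. F \<circ> next_map n F)"
  define H where "H n = next_map n (F n)" for n
  have F_0: "F 0 = F0" and F_Suc: "F (Suc n) = F n \<circ> H n" for n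
    by (simp_all add: F_def H_def)
  have F: "vp_automorphism (F n)" for n
  proof (induction n)
    case (Suc n)
    then show ?case
      using next_map[OF Suc, of n] unfolding F_Suc H_def good_def by (intro vp_automorphism_comp) auto
  qed (simp add: F_0 F0)
  have H: "good n (F n) (H n)" for n
    using next_map[OF F] by (simp add: H_def)
  have props: "r \<ge> 0" "\<And>n. vp_automorphism (H n)"
    "\<And>n z. z \<in> re_strip (r + real n) \<Longrightarrow> norm (H n z - z) \<le> (1/2) ^ Suc n"
    "\<And>n z. z \<in> re_strip (r + real n) \<Longrightarrow> norm (inv (H n) z - z) \<le> (1/2) ^ Suc n"
    "\<And>n. inv (H n) ` re_corners (r + real n + 2) \<subseteq> re_corners (r + real (Suc n) + 2)"
    "\<And>n z. norm z \<le> real n \<Longrightarrow> norm (F n (H n z) - F n z) \<le> (1/2) ^ n"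
    using H F0(2) unfolding good_def by auto
  note lims = limit_of_corrections[OF props(1) F props(2) F_Suc props(3-6)]
  have "avoided a K \<inter> range (\<lambda>z. lim (\<lambda>n. F n z)) = {}"
    using lims(4) F0(3) unfolding F_0 by blast
  moreover have "covered a K \<subseteq> range (\<lambda>z. lim (\<lambda>n. F n z))"
    using lims(5) F0(4) unfolding F_0 by blast
  ultimately show ?thesis
    using lims(1-3) by blast
qed

theorem theorem1p2:
  fixes a :: real and K :: int
  assumes "CARD('k::finite) \<ge> 2" and "a > 0" and "K \<ge> 1"
  shows "\<exists>F :: complex ^ 'k \<Rightarrow> complex ^ 'k.
    inj F \<and> holomorphic_map F \<and> volume_preserving F \<and>
    (\<forall>l :: 'k \<Rightarrow> int. (\<forall>i. 1 \<le> l i \<and> l i \<le> K + 1) \<longrightarrow>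
       cart_prod (\<lambda>i. V_set a K (l i)) \<inter> range F = {}) \<and>
    (\<forall>l :: 'k \<Rightarrow> int. (\<forall>i. 1 \<le> l i \<and> l i \<le> K + 1) \<longrightarrow>
       cart_prod (\<lambda>i. V_set a K (- l i)) \<inter> range F = {}) \<and>
    (\<forall>l :: 'k \<Rightarrow> int. (\<forall>i. 1 \<le> \<bar>l i\<bar> \<and> \<bar>l i\<bar> \<le> K + 1) \<longrightarrow>
       cart_prod (\<lambda>i. D_set a (l i)) \<inter> range F = {}) \<and>
    (\<forall>l :: 'k \<Rightarrow> int. (\<forall>i. 1 \<le> \<bar>l i\<bar> \<and> \<bar>l i\<bar> \<le> K + 1) \<longrightarrow>
       cart_prod (\<lambda>i. E_set a (l i)) \<subseteq> range F)"
proof -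
  obtain F :: "complex ^ 'k \<Rightarrow> complex ^ 'k" where F: "inj F" "holomorphic_map F" "volume_preserving F"
    and avoid: "avoided a K \<inter> range F = {}" and cover: "covered a K \<subseteq> range F"
    using map_avoiding_and_covering[OF assms] by blast
  have V: "cart_prod (\<lambda>i. V_set a K (l i)) \<subseteq> avoided a K" "cart_prod (\<lambda>i. V_set a K (- l i)) \<subseteq> avoided a K"
    if "\<forall>i. 1 \<le> l i \<and> l i \<le> K + 1" for l :: "'k \<Rightarrow> int"
    using that unfolding avoided_def by auto
  have D: "cart_prod (\<lambda>i. D_set a (l i)) \<subseteq> avoided a K" and E: "cart_prod (\<lambda>i. E_set a (l i)) \<subseteq> covered a K"
    if "\<forall>i. 1 \<le> \<bar>l i\<bar> \<and> \<bar>l i\<bar> \<le> K + 1" for l :: "'k \<Rightarrow> int"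
    using that unfolding avoided_def covered_def by auto
  show ?thesis
  proof (intro exI[of _ F] conjI allI impI F)
    fix l :: "'k \<Rightarrow> int" assume "\<forall>i. 1 \<le> l i \<and> l i \<le> K + 1"
    from V[OF this] avoid show "cart_prod (\<lambda>i. V_set a K (l i)) \<inter> range F = {}"
      "cart_prod (\<lambda>i. V_set a K (- l i)) \<inter> range F = {}" by blast+
  next
    fix l :: "'k \<Rightarrow> int" assume "\<forall>i. 1 \<le> \<bar>l i\<bar> \<and> \<bar>l i\<bar> \<le> K + 1"
    from D[OF this] E[OF this] avoid cover show "cart_prod (\<lambda>i. D_set a (l i)) \<inter> range F = {}"
      "cart_prod (\<lambda>i. E_set a (l i)) \<subseteq> range F" by blast+
  qed
qed

end
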